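(* For sufficiently large $t$, $$m(C_{2t})\le t^{-1/(1+\sqrt{2})+o(1)}\,\frac{(2t-1)!}{2},$$ where $o(1)$ denotes a quantity tending to $0$ as $t\to\infty$. That is, there is a function $\varepsilon:\mathbb{N}\to\mathbb{R}$ with $\varepsilon(t)\to 0$ as $t\to\infty$ such that for all sufficiently large integers $t$, $m(C_{2t})\le t^{-1/(1+\sqrt{2})+\varepsilon(t)}\,\frac{(2t-1)!}{2}$.
   Context: $C_n$ denotes the cycle on $n$ vertices. For a graph $H$, the Ramsey number $r(H)$ is the minimum positive integer $n$ such that every red/blue edge-coloring of the complete graph $K_n$ contains a monochromatic copy of $H$. The threshold Ramsey multiplicity $m(H)$ is the minimum, over all red/blue edge-colorings of $K_{r(H)}$, of the total number of monochromatic copies of $H$ (the number of red copies plus the number of blue copies). A copy of $H$ is an (unlabelled) subgraph of the complete graph isomorphic to $H$. *)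

theory Defs
  imports Complex_Main "HOL-Library.Ramsey"
begin

(* A finite simple graph (V, E): every edge is a two-element subset of V. *)
type_synonym 'a sgraph = "'a set \<times> 'a set set"

(* The cycle on n vertices; meaningful for n >= 3. *)
definition cycle_graph :: "nat \<Rightarrow> nat sgraph" where
  "cycle_graph n = ({..<n}, {{i, Suc i mod n} | i. i < n})"

definition graph_iso :: "'a sgraph \<Rightarrow> 'b sgraph \<Rightarrow> bool" where
  "graph_iso G H \<longleftrightarrow>
     (\<exists>f. bij_betw f (fst G) (fst H) \<and> snd H = (\<lambda>e. f ` e) ` snd G)"

(* Copies are unlabelled: each subgraph isomorphic to H is counted once. *)
definition copies :: "'a sgraph \<Rightarrow> 'b sgraph \<Rightarrow> 'b sgraph set" where
  "copies H G = {(W, F). W \<subseteq> fst G \<and> F \<subseteq> snd G \<and> graph_iso H (W, F)}"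

datatype colour = Red | Blue

(* The spanning subgraph of the complete graph on {..<n} formed by the edges of colour a.
   A colouring is a total function on sets of vertices, but only its values on
   two-element subsets of {..<n} are used. *)
definition colour_class :: "nat \<Rightarrow> (nat set \<Rightarrow> colour) \<Rightarrow> colour \<Rightarrow> nat sgraph" where
  "colour_class n c a = ({..<n}, {e \<in> nsets {..<n} 2. c e = a})"

(* For a finite graph H the LEAST exists by Ramsey's theorem. *)
definition ramsey_number :: "'a sgraph \<Rightarrow> nat" where
  "ramsey_number H =
     (LEAST n. 0 < n \<and> (\<forall>c. \<exists>a. copies H (colour_class n c a) \<noteq> {}))"

definition mono_count :: "'a sgraph \<Rightarrow> nat \<Rightarrow> (nat set \<Rightarrow> colour) \<Rightarrow> nat" where
  "mono_count H n c =
     card (copies H (colour_class n c Red)) + card (copies H (colour_class n c Blue))"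

definition threshold_ramsey_multiplicity :: "'a sgraph \<Rightarrow> nat" where
  "threshold_ramsey_multiplicity H =
     (LEAST k. \<exists>c. mono_count H (ramsey_number H) c = k)"

end

theory Submission
  imports Defs "HOL-Combinatorics.Multiset_Permutations" "HOL-Real_Asymp.Real_Asymp"
begin

text \<open>
  Only \<open>r(C\<^sub>2\<^sub>t) \<le> 3t - 1\<close> is needed, since restricting a colouring to fewer vertices does not
  increase the number of monochromatic copies. For this bound, a monochromatic \<open>C\<^sub>2\<^sub>k\<close> with
  \<open>k \<ge> 11\<close> in a colouring with at least \<open>3k + 2\<close> vertices yields a monochromatic \<open>C\<^sub>2\<^sub>k\<^sub>+\<^sub>2\<close>, and
  Ramsey's theorem gives a \<open>C\<^sub>2\<^sub>2\<close> to start from. If a red \<open>C\<^sub>2\<^sub>k\<close> cannot be lengthened, the red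
  neighbourhoods of any two outside vertices (apart from one exceptional vertex) together cover at most
  \<open>k + 1\<close> of its vertices, so these two have \<open>k - 1\<close> common blue neighbours on the cycle, and a blue \<open>C\<^sub>2\<^sub>k\<^sub>+\<^sub>2\<close>
  is built by choosing distinct representatives.

  For the multiplicity bound, take a red clique \<open>A\<close> on \<open>2t - 1\<close> vertices, a blue clique \<open>B\<close> on \<open>t\<close>
  vertices, and colour each edge between them red independently with probability
  \<open>p = \<alpha> ln t / (2t)\<close>, \<open>\<alpha> = 1 / (1 + \<surd>2)\<close>. A blue \<open>C\<^sub>2\<^sub>t\<close> has to alternate between the parts and
  survives with probability \<open>(1 - p)\<^sup>2\<^sup>t\<close>; a red one with \<open>k \<ge> 1\<close> vertices in \<open>B\<close> uses \<open>2k\<close>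
  edges between the parts. Both expectations are at most \<open>t\<close> to the power \<open>- \<alpha> + o(1)\<close> times
  \<open>(2t - 1)!\<close>.
\<close>

section \<open>Cycles as lists\<close>

definition cyc :: "('a \<Rightarrow> 'a \<Rightarrow> bool) \<Rightarrow> 'a list \<Rightarrow> bool" where
  "cyc P xs \<longleftrightarrow> distinct xs \<and> xs \<noteq> [] \<and> successively P xs \<and> P (last xs) (hd xs)"

lemma cyc_append_commute: "cyc P (xs @ ys) \<Longrightarrow> cyc P (ys @ xs)"
  by (cases "xs = []"; cases "ys = []") (auto simp: cyc_def successively_append_iff)

text \<open>Cutting the cycle behind \<open>p\<close> and behind \<open>q\<close> leaves two arcs
  \<open>ps\<close> and \<open>qs\<close>. Every longer red cycle built later is assembled from such
  arcs and new vertices.\<close>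

lemma cyc_obtain_successor:
  assumes us: "cyc P us"
  obtains \<sigma> where "bij_betw \<sigma> (set us) (set us)"
    and "\<And>p q. p \<in> set us \<Longrightarrow> q \<in> set us \<Longrightarrow> p \<noteq> q \<Longrightarrow>
      \<exists>ps qs. cyc P (ps @ qs) \<and> set (ps @ qs) = set us \<and> ps \<noteq> [] \<and> qs \<noteq> [] \<and>
        last ps = p \<and> hd qs = \<sigma> p \<and> last qs = q \<and> hd ps = \<sigma> q"
proof
  define \<sigma> where "\<sigma> p = the (map_of (zip us (rotate1 us)) p)" for p
  have d: "distinct us" and ne: "us \<noteq> []" using us by (auto simp: cyc_def)
  have \<sigma>: "\<sigma> (us ! i) = us ! (Suc i mod length us)" if "i < length us" for i
    using that d by (simp add: \<sigma>_def map_of_zip_nth nth_rotate1)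
  have "map \<sigma> us = rotate1 us"
    by (rule nth_equalityI) (auto simp: \<sigma> nth_rotate1)
  then have im: "\<sigma> ` set us = set us"
    by (metis set_map set_rotate1)
  then show "bij_betw \<sigma> (set us) (set us)"
    by (simp add: bij_betw_def eq_card_imp_inj_on)
  have *: "\<exists>ps qs. cyc P (ps @ qs) \<and> set (ps @ qs) = set us \<and> ps \<noteq> [] \<and> qs \<noteq> [] \<and>
        last ps = us ! i \<and> hd qs = \<sigma> (us ! i) \<and> last qs = us ! j \<and> hd ps = \<sigma> (us ! j)"
    if ij: "i < j" "j < length us" for i j
  proof -
    \<comment> \<open>\<open>A\<close> ends at position \<open>i\<close> and \<open>B\<close> at
      position \<open>j\<close>. Moving the rest \<open>D\<close> in front of \<open>A\<close> turns
      the cycle into the arcs \<open>D @ A\<close> and \<open>B\<close>.\<close>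
    define A B D where "A = take (Suc i) us" and "B = take (j - i) (drop (Suc i) us)"
      and "D = drop (Suc j) us"
    have dd: "drop (Suc i) us = B @ D"
    proof -
      have "drop (j - i) (drop (Suc i) us) = D" using ij by (simp add: D_def)
      then show ?thesis unfolding B_def by (metis append_take_drop_id)
    qed
    have u: "us = A @ B @ D" unfolding A_def by (metis append_take_drop_id dd)
    have A: "A \<noteq> []" "last A = us ! i" "hd A = us ! 0"
      using ij ne by (auto simp: A_def take_Suc_conv_app_nth hd_append hd_conv_nth)
    have B: "B \<noteq> []" "last B = us ! j" "hd B = us ! Suc i"
      using ij by (auto simp: B_def last_conv_nth hd_conv_nth)
    \<comment> \<open>If \<open>j\<close> is the last position, \<open>D\<close> is empty and the
      successor wraps round to \<open>us ! 0\<close>, the head of \<open>A\<close>.\<close>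
    have hdD: "hd (D @ A) = us ! (Suc j mod length us)"
    proof (cases "Suc j < length us")
      case True
      then have "D \<noteq> []" "hd D = us ! Suc j" by (auto simp: D_def hd_conv_nth)
      then show ?thesis using True by simp
    next
      case False
      then have "D = []" "Suc j = length us" using ij by (auto simp: D_def)
      then show ?thesis using A by simp
    qed
    have "cyc P ((D @ A) @ B)"
      using cyc_append_commute[of P "A @ B" D] us u by simp
    moreover have "set ((D @ A) @ B) = set us" by (subst u) auto
    moreover have "Suc i mod length us = Suc i" using ij by simp
    ultimately show ?thesis using A B hdD ij \<sigma>[of i] \<sigma>[of j]
      by (intro exI[of _ "D @ A"] exI[of _ B]) simp
  qed
  fix p q assume "p \<in> set us" "q \<in> set us" "p \<noteq> q"
  then obtain i j where ij: "i < length us" "j < length us" "p = us ! i" "q = us ! j" "i \<noteq> j"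
    by (metis in_set_conv_nth)
  show "\<exists>ps qs. cyc P (ps @ qs) \<and> set (ps @ qs) = set us \<and> ps \<noteq> [] \<and> qs \<noteq> [] \<and>
        last ps = p \<and> hd qs = \<sigma> p \<and> last qs = q \<and> hd ps = \<sigma> q"
  proof (cases "i < j")
    case True
    then show ?thesis using * ij by blast
  next
    case False
    then have "j < i" using ij by simp
    from *[OF this \<open>i < length us\<close>] obtain ps qs where pq:
      "cyc P (ps @ qs)" "set (ps @ qs) = set us" "ps \<noteq> []" "qs \<noteq> []"
      "last ps = q" "hd qs = \<sigma> q" "last qs = p" "hd ps = \<sigma> p" using ij by auto
    show ?thesis
      by (intro exI[of _ qs] exI[of _ ps]) (use pq cyc_append_commute[of P ps qs] in auto)
  qed
qed

section \<open>Interleaving lists and choosing distinct representatives\<close>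

fun weave :: "'a list \<Rightarrow> 'a list \<Rightarrow> 'a list" where
  "weave (x # xs) (y # ys) = x # y # weave xs ys"
| "weave xs [] = xs"
| "weave [] ys = ys"

lemma set_weave: "set (weave xs ys) = set xs \<union> set ys"
  by (induction xs ys rule: weave.induct) auto

lemma length_weave: "length (weave xs ys) = length xs + length ys"
  by (induction xs ys rule: weave.induct) auto

lemma distinct_weave:
  "distinct (weave xs ys) \<longleftrightarrow> distinct xs \<and> distinct ys \<and> set xs \<inter> set ys = {}"
  by (induction xs ys rule: weave.induct) (auto simp: set_weave)

lemma successively_weave:
  assumes "length xs = Suc (length ys)"
    and "\<And>i. i < length ys \<Longrightarrow> P (xs ! i) (ys ! i) \<and> P (ys ! i) (xs ! Suc i)"
  shows "successively P (weave xs ys) \<and> hd (weave xs ys) = hd xs \<and> last (weave xs ys) = last xs"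
  using assms
proof (induction ys arbitrary: xs)
  case Nil
  then show ?case by (cases xs) auto
next
  case (Cons y ys)
  then obtain x x' xs' where xs: "xs = x # x' # xs'"
    by (cases xs; cases "tl xs") auto
  have "successively P (weave (x' # xs') ys) \<and> hd (weave (x' # xs') ys) = hd (x' # xs')
      \<and> last (weave (x' # xs') ys) = last (x' # xs')"
  proof (rule Cons.IH)
    show "length (x' # xs') = Suc (length ys)" using Cons.prems(1) xs by simp
    show "P ((x' # xs') ! i) (ys ! i) \<and> P (ys ! i) ((x' # xs') ! Suc i)" if "i < length ys" for i
      using Cons.prems(2)[of "Suc i"] that xs by simp
  qed
  moreover have "P x y" "P y x'" using Cons.prems(2)[of 0] xs by auto
  moreover have "weave (x' # xs') ys \<noteq> []" by (cases ys) auto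
  ultimately show ?case unfolding xs by (auto simp: successively_Cons)
qed

text \<open>Since \<open>xs\<close> is one longer than \<open>ys\<close>, the interleaving starts
  and ends in \<open>xs\<close>, and the single vertex \<open>v\<close> closes it up.\<close>

lemma cyc_weave:
  assumes "length xs = Suc (length ys)"
    and "\<And>i. i < length ys \<Longrightarrow> P (xs ! i) (ys ! i) \<and> P (ys ! i) (xs ! Suc i)"
    and "distinct xs" "distinct ys" "set xs \<inter> set ys = {}" "v \<notin> set xs \<union> set ys"
    and "P (last xs) v" "P v (hd xs)"
  shows "cyc P (weave xs ys @ [v])"
proof -
  have "weave xs ys \<noteq> []" using assms(1) by (cases xs; cases ys) auto
  then show ?thesis
    using assms successively_weave[OF assms(1,2)]
    by (auto simp: cyc_def distinct_weave set_weave successively_append_iff)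
qed

lemma inj_on_insert_update:
  assumes "inj_on f I" "i \<notin> I" "s \<notin> f ` I"
  shows "inj_on (f(i := s)) (insert i I)"
proof -
  have "(f(i := s)) ` I = f ` I" using assms(2) by auto
  moreover have "inj_on (f(i := s)) I"
    using assms(1,2) by (auto simp: inj_on_def)
  ultimately show ?thesis using assms(2,3) by simp
qed

text \<open>Each set is larger than the number of values already used or forbidden when its turn
  comes. The set \<open>F\<close> carries the induction: a chosen value is passed on as
  forbidden.\<close>

lemma greedy_distinct_representatives:
  assumes "finite I" "finite F"
    and "\<And>i. i \<in> I \<Longrightarrow> finite (S i) \<and> card I + card F \<le> card (S i)"
  shows "\<exists>f. inj_on f I \<and> (\<forall>i\<in>I. f i \<in> S i - F)"
  using assms
proof (induction I arbitrary: F rule: finite_induct)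
  case empty
  then show ?case by simp
next
  case (insert i I)
  have "card F < card (S i)" "finite (S i)" using insert by force+
  then obtain s where s: "s \<in> S i" "s \<notin> F"
    using insert.prems(1) by (meson card_mono linorder_not_less subsetI)
  have "\<exists>f. inj_on f I \<and> (\<forall>i\<in>I. f i \<in> S i - insert s F)"
    by (rule insert.IH) (use insert s in auto)
  then obtain f where f: "inj_on f I" "\<forall>i\<in>I. f i \<in> S i - insert s F" by blast
  have "inj_on (f(i := s)) (insert i I)"
    by (rule inj_on_insert_update) (use f s insert.hyps in auto)
  moreover have "\<forall>j\<in>insert i I. (f(i := s)) j \<in> S j - F" using f s by auto
  ultimately show ?case by blast
qed

section \<open>Lengthening a monochromatic even cycle\<close>

text \<open>
  The situation of a red cycle of length \<open>2 * k\<close> with vertex set \<open>C\<close> and successor map \<open>\<sigma>\<close>, in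
  which every pattern that would extend the cycle to a red cycle of length \<open>2 * k + 2\<close> through
  vertices of \<open>D\<close> is excluded. Two vertices that could both be inserted at two different places would
  violate \<open>two_insertions\<close>, so at most one vertex of \<open>D\<close> has two such places; \<open>x0\<close> is this vertex if
  it exists.
\<close>

locale red_cycle_and_outside =
  fixes R :: "'a \<Rightarrow> 'a \<Rightarrow> bool" and C D :: "'a set" and \<sigma> :: "'a \<Rightarrow> 'a" and k :: nat and x0 :: 'a
  assumes R_sym: "R x y \<Longrightarrow> R y x"
    and finite_C: "finite C" and card_C: "card C = 2 * k" and bij: "bij_betw \<sigma> C C"
    and finite_D: "finite D" and card_D: "card D = k + 2" and disj: "C \<inter> D = {}"
    and k_ge: "11 \<le> k" and x0: "x0 \<in> D"
    and two_insertions: "\<lbrakk>x \<in> D; y \<in> D; x \<noteq> y; p \<in> C; q \<in> C; p \<noteq> q;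
      R x p; R x (\<sigma> p); R y q; R y (\<sigma> q)\<rbrakk> \<Longrightarrow> False"
    and crossing: "\<lbrakk>x \<in> D; y \<in> D; x \<noteq> y; p \<in> C; q \<in> C; p \<noteq> q;
      R x p; R x q; R y (\<sigma> p); R y (\<sigma> q)\<rbrakk> \<Longrightarrow> False"
    and detour: "\<lbrakk>x \<in> D; y \<in> D; z \<in> D; x \<noteq> y; y \<noteq> z; x \<noteq> z;
      p \<in> C; R x y; R x z; R y p; R z (\<sigma> (\<sigma> p))\<rbrakk> \<Longrightarrow> False"
    and one_insertion: "\<lbrakk>x \<in> D; x \<noteq> x0; p \<in> C; q \<in> C; p \<noteq> q;
      R x p; R x (\<sigma> p); R x q; R x (\<sigma> q)\<rbrakk> \<Longrightarrow> False"
begin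

section \<open>Red neighbourhoods and common blue neighbours of outside vertices\<close>

definition red_nbrs :: "'a \<Rightarrow> 'a set" where "red_nbrs x = {p \<in> C. R x p}"
definition common_blue :: "'a \<Rightarrow> 'a \<Rightarrow> 'a set" where "common_blue x y = C - (red_nbrs x \<union> red_nbrs y)"
definition D' :: "'a set" where "D' = D - {x0}"

definition blue_cycle :: bool where
  "blue_cycle \<longleftrightarrow> (\<exists>vs. set vs \<subseteq> C \<union> D \<and> length vs = 2 * k + 2 \<and> cyc (\<lambda>x y. \<not> R x y) vs)"

lemma red_nbrs_subset: "red_nbrs x \<subseteq> C" by (auto simp: red_nbrs_def)
lemma finite_red_nbrs [simp]: "finite (red_nbrs x)" using red_nbrs_subset finite_C finite_subset by blast
lemma finite_common_blue [simp]: "finite (common_blue x y)" using finite_C by (auto simp: common_blue_def)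
lemma card_D': "card D' = k + 1" using x0 card_D finite_D by (simp add: D'_def)
lemma finite_D': "finite D'" using finite_D by (simp add: D'_def)
lemma \<sigma>_in: "p \<in> C \<Longrightarrow> \<sigma> p \<in> C" using bij by (auto simp: bij_betw_def)

lemma card_union: "card (red_nbrs x \<union> red_nbrs y) + card (common_blue x y) = 2 * k"
proof -
  have "red_nbrs x \<union> red_nbrs y \<subseteq> C" using red_nbrs_subset by blast
  then show ?thesis unfolding common_blue_def
    using card_Diff_subset[of "red_nbrs x \<union> red_nbrs y" C] card_mono[OF finite_C, of "red_nbrs x \<union> red_nbrs y"] card_C by simp
qed

text \<open>\<open>X\<close> and its shift have equal size and lie in a set of size
  \<open>2 * k\<close>. So a bound on the number of successive pairs inside \<open>X\<close> bounds
  \<open>card X\<close> by \<open>k\<close> plus a constant.\<close>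

lemma card_shift:
  assumes "X \<subseteq> C"
  shows "card (X \<union> \<sigma> ` X) + card (X \<inter> \<sigma> ` X) = 2 * card X" "card (X \<union> \<sigma> ` X) \<le> 2 * k"
proof -
  have fin: "finite X" using assms finite_C finite_subset by blast
  have "card (\<sigma> ` X) = card X"
    using bij assms by (metis bij_betw_def card_image inj_on_subset)
  then show "card (X \<union> \<sigma> ` X) + card (X \<inter> \<sigma> ` X) = 2 * card X"
    using card_Un_Int[OF fin finite_imageI[OF fin], of \<sigma>] by simp
  have "X \<union> \<sigma> ` X \<subseteq> C" using assms \<sigma>_in by blast
  then show "card (X \<union> \<sigma> ` X) \<le> 2 * k" using card_mono[OF finite_C] card_C by metis
qed

text \<open>Two elements \<open>\<sigma> p\<close> and \<open>\<sigma> q\<close> of the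
  intersection, with \<open>p\<close> and \<open>q\<close> red neighbours of \<open>x\<close>, form
  the pattern excluded by \<open>crossing\<close>.\<close>

lemma crossing_card:
  assumes "x \<in> D" "y \<in> D" "x \<noteq> y"
  shows "card (red_nbrs y \<inter> \<sigma> ` red_nbrs x) \<le> 1"
proof -
  have "a = b" if "a \<in> red_nbrs y \<inter> \<sigma> ` red_nbrs x" "b \<in> red_nbrs y \<inter> \<sigma> ` red_nbrs x" for a b
  proof -
    from that obtain p q where "p \<in> C" "q \<in> C" "R x p" "R x q" "a = \<sigma> p" "b = \<sigma> q" "R y a" "R y b"
      by (auto simp: red_nbrs_def)
    then show ?thesis using crossing[of x y p q] assms by blast
  qed
  then show ?thesis by (simp add: card_le_Suc0_iff_eq)
qed

text \<open>Different vertices are covered by \<open>two_insertions\<close>, equal ones by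
  \<open>one_insertion\<close>; the latter is why \<open>x0\<close> is removed from
  \<open>D\<close>.\<close>

lemma insertion_unique:
  assumes "x \<in> D'" "y \<in> D'" "p \<in> red_nbrs x" "\<sigma> p \<in> red_nbrs x" "q \<in> red_nbrs y" "\<sigma> q \<in> red_nbrs y"
  shows "p = q"
proof (rule ccontr)
  assume "p \<noteq> q"
  moreover have "p \<in> C" "q \<in> C" "R x p" "R x (\<sigma> p)" "R y q" "R y (\<sigma> q)" "x \<in> D" "y \<in> D" "x \<noteq> x0"
    using assms by (auto simp: red_nbrs_def D'_def)
  ultimately show False
    using two_insertions[of x y p q] one_insertion[of x p q] by blast
qed

text \<open>A successive pair in the union lies within one neighbourhood or is mixed. All pairs of
  the first kind coincide by \<open>insertion_unique\<close>, and each of the two mixed orders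
  occurs at most once by \<open>crossing_card\<close>.\<close>

lemma card_shift_pair:
  assumes "x \<in> D'" "y \<in> D'" "x \<noteq> y"
  shows "card ((red_nbrs x \<union> red_nbrs y) \<inter> \<sigma> ` (red_nbrs x \<union> red_nbrs y)) \<le> 3"
proof -
  have D: "x \<in> D" "y \<in> D" using assms by (auto simp: D'_def)
  have "p = q" if "\<sigma> p \<in> red_nbrs u" "p \<in> red_nbrs u" "\<sigma> q \<in> red_nbrs v" "q \<in> red_nbrs v" "u \<in> {x, y}" "v \<in> {x, y}" for p q u v
    using insertion_unique[of u v p q] that assms by blast
  then have "\<forall>a \<in> red_nbrs x \<inter> \<sigma> ` red_nbrs x \<union> red_nbrs y \<inter> \<sigma> ` red_nbrs y. \<forall>b \<in> red_nbrs x \<inter> \<sigma> ` red_nbrs x \<union> red_nbrs y \<inter> \<sigma> ` red_nbrs y. a = b"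
    by blast
  then have "card (red_nbrs x \<inter> \<sigma> ` red_nbrs x \<union> red_nbrs y \<inter> \<sigma> ` red_nbrs y) \<le> 1"
    unfolding One_nat_def by (rule iffD2[OF card_le_Suc0_iff_eq, rotated]) simp
  moreover have "(red_nbrs x \<union> red_nbrs y) \<inter> \<sigma> ` (red_nbrs x \<union> red_nbrs y) =
    (red_nbrs x \<inter> \<sigma> ` red_nbrs x \<union> red_nbrs y \<inter> \<sigma> ` red_nbrs y) \<union> (red_nbrs y \<inter> \<sigma> ` red_nbrs x) \<union> (red_nbrs x \<inter> \<sigma> ` red_nbrs y)" by auto
  moreover have "card ((red_nbrs x \<inter> \<sigma> ` red_nbrs x \<union> red_nbrs y \<inter> \<sigma> ` red_nbrs y) \<union> (red_nbrs y \<inter> \<sigma> ` red_nbrs x) \<union> (red_nbrs x \<inter> \<sigma> ` red_nbrs y))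
    \<le> card (red_nbrs x \<inter> \<sigma> ` red_nbrs x \<union> red_nbrs y \<inter> \<sigma> ` red_nbrs y) + card (red_nbrs y \<inter> \<sigma> ` red_nbrs x) + card (red_nbrs x \<inter> \<sigma> ` red_nbrs y)"
    by (meson add_le_mono1 card_Un_le order_trans)
  ultimately show ?thesis
    using crossing_card[of x y] crossing_card[of y x] D assms(3) by simp
qed

text \<open>The union \<open>X\<close> of the two red neighbourhoods satisfies
  \<open>2 * card X \<le> 2 * k + 3\<close>, hence \<open>card X \<le> k + 1\<close> by
  parity.\<close>

lemma card_common_blue_ge:
  assumes "x \<in> D'" "y \<in> D'" "x \<noteq> y"
  shows "k - 1 \<le> card (common_blue x y)"
  using card_shift[of "red_nbrs x \<union> red_nbrs y"] card_shift_pair[OF assms] card_union[of x y] red_nbrs_subset[of x]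
    red_nbrs_subset[of y] by simp

section \<open>Construction of the blue cycle\<close>

text \<open>\<open>zs\<close> contributes \<open>k + 1\<close> vertices, the representatives
  contribute \<open>k\<close>, and \<open>v\<close> closes the cycle. In one application
  \<open>v\<close> is \<open>x0\<close>, in the other it is a further representative in
  \<open>C\<close>.\<close>

lemma blue_cycleI:
  assumes zs: "distinct zs" "set zs \<subseteq> D" "length zs = k + 1"
    and f: "inj_on f {..<k}" "\<And>i. i < k \<Longrightarrow> f i \<in> common_blue (zs ! i) (zs ! Suc i)"
    and v: "v \<in> C \<union> D" "v \<notin> set zs" "v \<notin> f ` {..<k}" "\<not> R v (hd zs)" "\<not> R v (last zs)"
  shows blue_cycle
proof -
  define ss where "ss = map f [0..<k]"
  have set_ss: "set ss = f ` {..<k}" by (auto simp: ss_def)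
  have "f ` {..<k} \<subseteq> C" using f(2) by (auto simp: common_blue_def)
  have "cyc (\<lambda>x y. \<not> R x y) (weave zs ss @ [v])"
  proof (rule cyc_weave)
    show "length zs = Suc (length ss)" using zs by (simp add: ss_def)
    show "\<not> R (zs ! i) (ss ! i) \<and> \<not> R (ss ! i) (zs ! Suc i)" if "i < length ss" for i
      using that f(2)[of i] R_sym by (auto simp: ss_def common_blue_def red_nbrs_def)
    show "distinct ss" using f(1) by (simp add: ss_def distinct_map lessThan_atLeast0)
    show "set zs \<inter> set ss = {}" using \<open>f ` {..<k} \<subseteq> C\<close> zs disj set_ss by blast
  qed (use zs v set_ss R_sym in auto)
  moreover have "set (weave zs ss @ [v]) \<subseteq> C \<union> D"
    using \<open>f ` {..<k} \<subseteq> C\<close> zs v set_ss by (auto simp: set_weave)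
  moreover have "length (weave zs ss @ [v]) = 2 * k + 2"
    using zs by (simp add: length_weave ss_def)
  ultimately show ?thesis unfolding blue_cycle_def by blast
qed

text \<open>
  The blue cycle sought runs through \<open>x0\<close> and then along \<open>zs\<close>, with a common blue neighbour from
  \<open>C\<close> between any two consecutive entries. These \<open>k\<close> sets have at least \<open>k - 1\<close> elements each, so
  distinct representatives fail to exist only if all the sets coincide.
\<close>

lemma common_blue_sets_equal:
  assumes zs: "distinct zs" "set zs = D'" and x0zs: "\<not> R x0 (hd zs)" "\<not> R x0 (last zs)"
    and no: "\<not> blue_cycle"
  shows "\<exists>T. card T = k - 1 \<and> (\<forall>i<k. common_blue (zs ! i) (zs ! Suc i) = T)"
proof -
  define G where "G i = common_blue (zs ! i) (zs ! Suc i)" for i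
  have len: "length zs = k + 1" using zs card_D' distinct_card by metis
  have G_ge: "k - 1 \<le> card (G i)" if "i < k" for i
    unfolding G_def
  proof (rule card_common_blue_ge)
    show "zs ! i \<in> D'" "zs ! Suc i \<in> D'" using that len nth_mem[of _ zs] zs(2) by auto
    show "zs ! i \<noteq> zs ! Suc i" using that len zs(1) by (simp add: nth_eq_iff_index_eq)
  qed
  have no_sdr: False if "inj_on f {..<k}" "\<And>i. i < k \<Longrightarrow> f i \<in> G i" for f
  proof -
    have "f ` {..<k} \<subseteq> C" using that by (auto simp: G_def common_blue_def)
    then have "x0 \<notin> f ` {..<k}" using x0 disj by blast
    then show False
      using blue_cycleI[of zs f x0] that zs len x0zs x0 no by (auto simp: G_def D'_def)
  qed
  have le: "G a \<subseteq> G b" if ab: "a < k" "b < k" "a \<noteq> b" for a b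
  proof (rule ccontr)
    assume "\<not> G a \<subseteq> G b"
    then obtain w where w: "w \<in> G a" "w \<notin> G b" by blast
    \<comment> \<open>Let \<open>w\<close> represent \<open>a\<close>, choose the
      \<open>k - 2\<close> values on \<open>I\<close> so as to avoid \<open>w\<close>, and serve
      \<open>b\<close> last: \<open>w\<close> is not in \<open>G b\<close>, so at most
      \<open>k - 2\<close> of its \<open>k - 1\<close> or more elements are taken.\<close>
    define I where "I = {..<k} - {a, b}"
    have cI: "card I = k - 2" using ab by (simp add: I_def card_Diff_subset)
    have "\<exists>f. inj_on f I \<and> (\<forall>i\<in>I. f i \<in> G i - {w})"
    proof (rule greedy_distinct_representatives)
      show "finite (G i) \<and> card I + card {w} \<le> card (G i)" if "i \<in> I" for i
        using G_ge[of i] cI k_ge that by (simp add: I_def G_def)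
    qed (simp_all add: I_def)
    then obtain f where f: "inj_on f I" "\<forall>i\<in>I. f i \<in> G i - {w}" by blast
    have "card (f ` I) < card (G b)"
      using card_image_le[of I f] cI G_ge[OF ab(2)] k_ge by (simp add: I_def)
    then obtain s where s: "s \<in> G b" "s \<notin> f ` I"
      by (metis G_def card_mono finite_imageI finite_Diff finite_lessThan I_def linorder_not_less subsetI)
    have I: "{..<k} = insert b (insert a I)" "a \<notin> I" "b \<notin> insert a I"
      using ab by (auto simp: I_def)
    have "inj_on (f(a := w)) (insert a I)"
      using f I by (intro inj_on_insert_update) auto
    moreover have "s \<notin> (f(a := w)) ` insert a I"
      using s w I by auto
    ultimately have "inj_on (f(a := w, b := s)) {..<k}"
      unfolding I(1) using I(3) by (metis inj_on_insert_update)
    then show False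
      by (rule no_sdr) (use f s w ab in \<open>auto simp: I_def\<close>)
  qed
  have eq: "G i = G 0" if "i < k" for i
    using le[of i 0] le[of 0 i] that by (cases "i = 0") auto
  \<comment> \<open>\<open>k\<close> equal sets of size at least \<open>k\<close> would have
    distinct representatives.\<close>
  have "\<not> k \<le> card (G 0)"
  proof
    assume "k \<le> card (G 0)"
    have "\<exists>f. inj_on f {..<k} \<and> (\<forall>i\<in>{..<k}. f i \<in> G i - {})"
    proof (rule greedy_distinct_representatives)
      show "finite (G i) \<and> card {..<k} + card {} \<le> card (G i)" if "i \<in> {..<k}" for i
        using \<open>k \<le> card (G 0)\<close> eq[of i] that by (simp add: G_def)
    qed simp_all
    then show False using no_sdr by auto
  qed
  then have "card (G 0) = k - 1" using G_ge[of 0] k_ge by simp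
  then show ?thesis using eq unfolding G_def by blast
qed

text \<open>\<open>x0\<close> joins the ends \<open>y\<close> and \<open>z\<close> of the path. If
  all attempts fail, there are three vertices any two of whose red neighbourhoods have the same
  union, of size \<open>k + 1\<close>. Such a union contains at least two successive pairs, which
  \<open>insertion_unique\<close> rules out.\<close>

lemma blue_cycle_if_two_blue:
  assumes yz: "y \<in> D'" "z \<in> D'" "y \<noteq> z" "\<not> R x0 y" "\<not> R x0 z"
  shows blue_cycle
proof (rule ccontr)
  assume no: "\<not> blue_cycle"
  have "finite (D' - {y, z})" using finite_D' by simp
  then obtain ws where ws: "set ws = D' - {y, z}" "distinct ws"
    using finite_distinct_list by metis
  have "length ws = k - 1"
    using ws yz card_D' distinct_card[of ws] finite_D' by (simp add: card_Diff_subset)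
  then have "Suc (Suc (Suc (Suc 0))) \<le> length ws" using k_ge by simp
  then obtain a b c d us where abcd: "ws = a # b # c # d # us"
    by (auto simp: Suc_le_length_iff)
  txt \<open>Both orders contain the pair \<open>c\<close>, \<open>d\<close>, so all the common blue sets are one set, although
    the two orders differ in their other pairs.\<close>
  define zs1 zs2 where "zs1 = y # ws @ [z]" and "zs2 = y # b # a # c # d # us @ [z]"
  obtain T1 where T1: "card T1 = k - 1" "\<forall>i<k. common_blue (zs1 ! i) (zs1 ! Suc i) = T1"
    using common_blue_sets_equal[of zs1] ws yz no by (auto simp: zs1_def)
  have "set zs2 = D'" "distinct zs2" using ws yz abcd by (auto simp: zs2_def)
  then obtain T2 where T2: "card T2 = k - 1" "\<forall>i<k. common_blue (zs2 ! i) (zs2 ! Suc i) = T2"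
    using common_blue_sets_equal[of zs2] yz no unfolding zs2_def by auto
  have e: "common_blue y a = T1" "common_blue a b = T1" "common_blue c d = T1"
    using T1(2)[rule_format, of 0] T1(2)[rule_format, of 1] T1(2)[rule_format, of 3] k_ge
    by (auto simp: zs1_def abcd)
  have "common_blue y b = T2" "common_blue c d = T2"
    using T2(2)[rule_format, of 0] T2(2)[rule_format, of 3] k_ge by (auto simp: zs2_def)
  with e have e': "common_blue y b = T1" by simp
  define X where "X = C - T1"
  have X: "X = red_nbrs y \<union> red_nbrs a" "X = red_nbrs a \<union> red_nbrs b" "X = red_nbrs y \<union> red_nbrs b"
    using e e' red_nbrs_subset[of y] red_nbrs_subset[of a] red_nbrs_subset[of b] unfolding X_def common_blue_def by blast+
  have "card X = k + 1" using card_union[of y a] e T1 X k_ge by simp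
  then have "2 \<le> card (X \<inter> \<sigma> ` X)" using card_shift[of X] by (simp add: X_def)
  moreover have "finite (X \<inter> \<sigma> ` X)" using finite_C by (simp add: X_def)
  ultimately have "\<not> (\<forall>u\<in>X \<inter> \<sigma> ` X. \<forall>v\<in>X \<inter> \<sigma> ` X. u = v)"
    by (metis card_le_Suc0_iff_eq numeral_2_eq_2 not_less_eq_eq)
  then obtain p q where pq: "p \<in> X" "q \<in> X" "\<sigma> p \<in> X" "\<sigma> q \<in> X" "\<sigma> p \<noteq> \<sigma> q" by blast
  \<comment> \<open>Each element of \<open>X\<close> is missing from at most one of the three
    neighbourhoods, so any two elements share one.\<close>
  have "\<exists>x\<in>{y, a, b}. p \<in> red_nbrs x \<and> \<sigma> p \<in> red_nbrs x" if "p \<in> X" "\<sigma> p \<in> X" for p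
    using that X by blast
  from this[of p] this[of q] pq
  obtain x x' where x: "x \<in> {y, a, b}" "p \<in> red_nbrs x" "\<sigma> p \<in> red_nbrs x"
    "x' \<in> {y, a, b}" "q \<in> red_nbrs x'" "\<sigma> q \<in> red_nbrs x'" by metis
  have "{y, a, b} \<subseteq> D'" using yz ws abcd by auto
  with x have "p = q" using insertion_unique[of x x' p q] by blast
  then show False using pq by simp
qed

text \<open>
  The detour \<open>x - x0 - w\<close> forbids the red neighbours of \<open>w\<close> to meet \<open>\<sigma> ` \<sigma> ` X\<close>, and they meet
  \<open>\<sigma> ` X\<close> at most twice; for large \<open>X\<close> these two images almost exhaust \<open>C\<close>.
\<close>

lemma small_neighbourhood:
  assumes Y: "x \<in> D'" "y \<in> D'" "w \<in> D'" "x \<noteq> y" "x \<noteq> w" "y \<noteq> w" "R x0 x" "R x0 y" "R x0 w"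
    and big: "k \<le> card (red_nbrs x \<union> red_nbrs y)"
  shows "card (red_nbrs w) \<le> 5"
proof -
  define X where "X = red_nbrs x \<union> red_nbrs y"
  have XC: "X \<subseteq> C" using red_nbrs_subset X_def by auto
  have YD: "x \<in> D" "y \<in> D" "w \<in> D" "x0 \<noteq> x" "x0 \<noteq> y" "x0 \<noteq> w" using Y by (auto simp: D'_def)
  have c: "card (X \<union> \<sigma> ` X) \<ge> 2 * k - 3"
    using card_shift(1)[OF XC] card_shift_pair[of x y] Y big by (simp add: X_def)
  \<comment> \<open>\<open>Z\<close> joins the first and second shifts of \<open>X\<close>; it
    misses at most three vertices of \<open>C\<close>.\<close>
  define Z where "Z = \<sigma> ` (X \<union> \<sigma> ` X)"
  have sub: "X \<union> \<sigma> ` X \<subseteq> C" using XC \<sigma>_in by blast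
  have "card Z = card (X \<union> \<sigma> ` X)"
    unfolding Z_def using bij sub by (metis bij_betw_def card_image inj_on_subset)
  moreover have ZC: "Z \<subseteq> C" using sub \<sigma>_in by (auto simp: Z_def)
  ultimately have CZ: "card (C - Z) \<le> 3"
    using c card_C finite_C by (simp add: card_Diff_subset finite_subset)
  have "red_nbrs w \<inter> \<sigma> ` \<sigma> ` X = {}"
  proof -
    have False if "p \<in> X" "\<sigma> (\<sigma> p) \<in> red_nbrs w" for p
      using that detour[of x0 x w p] detour[of x0 y w p] Y YD x0 by (auto simp: X_def red_nbrs_def)
    then show ?thesis by blast
  qed
  then have "red_nbrs w \<subseteq> (red_nbrs w \<inter> \<sigma> ` red_nbrs x) \<union> (red_nbrs w \<inter> \<sigma> ` red_nbrs y) \<union> (C - Z)"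
    using red_nbrs_subset[of w] by (auto simp: Z_def X_def)
  then have "card (red_nbrs w) \<le> card ((red_nbrs w \<inter> \<sigma> ` red_nbrs x) \<union> (red_nbrs w \<inter> \<sigma> ` red_nbrs y) \<union> (C - Z))"
    by (intro card_mono) (use finite_C in auto)
  also have "\<dots> \<le> card (red_nbrs w \<inter> \<sigma> ` red_nbrs x) + card (red_nbrs w \<inter> \<sigma> ` red_nbrs y) + card (C - Z)"
    by (meson add_le_mono1 card_Un_le order_trans)
  also have "\<dots> \<le> 1 + 1 + 3"
    using crossing_card[of x w] crossing_card[of y w] Y YD CZ by (intro add_mono) auto
  finally show ?thesis by simp
qed

text \<open>The cycle now avoids \<open>x0\<close>, so all \<open>k + 1\<close> cyclically
  consecutive pairs need a representative. The \<open>k - 1\<close> ordinary pairs are served first;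
  the two heavy sets, with at least \<open>k + 1\<close> elements, still have a free element
  afterwards.\<close>

lemma blue_cycle_if_heavy_path:
  assumes pqr: "p \<in> D'" "q \<in> D'" "r \<in> D'" "distinct [p, q, r]"
    and heavy: "k + 1 \<le> card (common_blue p q)" "k + 1 \<le> card (common_blue q r)"
  shows blue_cycle
proof -
  have "finite (D' - {p, q, r})" using finite_D' by simp
  then obtain ws where ws: "set ws = D' - {p, q, r}" "distinct ws"
    using finite_distinct_list by metis
  define zs where "zs = p # q # r # ws"
  have zs: "distinct zs" "set zs = D'" using ws pqr by (auto simp: zs_def)
  then have len: "length zs = k + 1" using card_D' distinct_card by metis
  define G where "G i = common_blue (zs ! i) (zs ! (Suc i mod (k + 1)))" for i
  have G_ge: "k - 1 \<le> card (G i)" if "i \<le> k" for i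
  proof -
    have "Suc i mod (k + 1) \<noteq> i" "Suc i mod (k + 1) < k + 1"
      using that k_ge by (cases "i = k") auto
    then show ?thesis
      unfolding G_def using that zs(1) len nth_mem[of _ zs] zs(2)
      by (intro card_common_blue_ge) (simp_all add: nth_eq_iff_index_eq)
  qed
  have G01: "k + 1 \<le> card (G 0)" "k + 1 \<le> card (G 1)" "finite (G i)" for i
    using heavy k_ge by (auto simp: G_def zs_def)
  have cI: "card {2..k} = k - 1" by simp
  obtain f where f: "inj_on f {2..k}" "\<forall>i\<in>{2..k}. f i \<in> G i - {}"
    using greedy_distinct_representatives[of "{2..k}" "{}" G] G_ge G01 by force
  have "card (f ` {2..k}) < card (G 0)"
    using card_image_le[of "{2..k}" f] G01 by simp
  then obtain s where s: "s \<in> G 0" "s \<notin> f ` {2..k}"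
    by (metis card_mono finite_imageI finite_atLeastAtMost linorder_not_less subsetI)
  have "card (insert s (f ` {2..k})) \<le> Suc (card (f ` {2..k}))" by (simp add: card_insert_if)
  then have "card (insert s (f ` {2..k})) < card (G 1)"
    using card_image_le[of "{2..k}" f] G01(2) k_ge by simp
  then obtain s' where s': "s' \<in> G 1" "s' \<notin> insert s (f ` {2..k})"
    by (metis card_mono finite_imageI finite_insert finite_atLeastAtMost linorder_not_less subsetI)
  define g where "g = f(0 := s, 1 := s')"
  have eq: "{..k} = insert 1 (insert 0 {2..k})" using k_ge by auto
  have "inj_on (f(0 := s)) (insert 0 {2..k})"
    using f s by (intro inj_on_insert_update) auto
  moreover have "s' \<notin> (f(0 := s)) ` insert 0 {2..k}" using s' by auto
  ultimately have "inj_on g {..k}"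
    unfolding eq g_def by (intro inj_on_insert_update[where i = 1]) (blast | simp)+
  have gG: "g i \<in> G i" if "i \<le> k" for i
    using that f s s' by (auto simp: g_def)
  show ?thesis
  proof (rule blue_cycleI)
    show "inj_on g {..<k}" using \<open>inj_on g {..k}\<close> by (rule inj_on_subset) auto
    show "g i \<in> common_blue (zs ! i) (zs ! Suc i)" if "i < k" for i using gG[of i] that by (simp add: G_def)
    have gk: "g k \<in> common_blue (zs ! k) (zs ! 0)" using gG[of k] by (simp add: G_def)
    then show "g k \<in> C \<union> D" by (auto simp: common_blue_def)
    show "g k \<notin> set zs" using gk zs disj by (auto simp: common_blue_def D'_def)
    show "g k \<notin> g ` {..<k}"
    proof
      assume "g k \<in> g ` {..<k}"
      then obtain i where "i < k" "g k = g i" by auto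
      then show False using inj_onD[OF \<open>inj_on g {..k}\<close>, of k i] by simp
    qed
    show "\<not> R (g k) (hd zs)" "\<not> R (g k) (last zs)"
      using gk len R_sym by (auto simp: common_blue_def red_nbrs_def hd_conv_nth last_conv_nth zs_def)
  qed (use zs len in \<open>auto simp: D'_def\<close>)
qed

text \<open>Otherwise \<open>x0\<close> has at least five red neighbours in \<open>D'\<close>. Call
  a pair heavy if it has at least \<open>k + 1\<close> common blue neighbours. By
  \<open>small_neighbourhood\<close>, a pair that is not heavy makes every pair disjoint from it
  heavy, so the five vertices contain a path of two heavy pairs.\<close>

lemma blue_cycle_exists: blue_cycle
proof (cases "\<exists>y z. y \<in> D' \<and> z \<in> D' \<and> y \<noteq> z \<and> \<not> R x0 y \<and> \<not> R x0 z")
  case True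
  then show ?thesis using blue_cycle_if_two_blue by blast
next
  case False
  define Y where "Y = {y \<in> D'. R x0 y}"
  have "card {y \<in> D'. \<not> R x0 y} \<le> 1"
    using False finite_D' by (auto simp: card_le_Suc0_iff_eq)
  moreover have "card Y + card {y \<in> D'. \<not> R x0 y} = card D'"
    unfolding Y_def using finite_D' by (subst card_Un_disjoint[symmetric]) (auto intro: arg_cong[where f = card])
  ultimately have "5 \<le> card Y" using card_D' k_ge by simp
  moreover obtain ys where ys: "set ys = Y" "distinct ys"
    using finite_D' finite_distinct_list[of Y] by (auto simp: Y_def)
  ultimately have "Suc (Suc (Suc (Suc (Suc 0)))) \<le> length ys" using distinct_card by fastforce
  then obtain a b c d e us where abcde: "ys = a # b # c # d # e # us"
    by (auto simp: Suc_le_length_iff)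
  have dist: "distinct [a, b, c, d, e]" and sub: "{a, b, c, d, e} \<subseteq> Y"
    using ys abcde by auto
  have small: "k + 1 \<le> card (common_blue u v)"
    if "x \<in> Y" "y \<in> Y" "u \<in> Y" "v \<in> Y" "x \<noteq> y" "x \<noteq> u" "y \<noteq> u" "x \<noteq> v" "y \<noteq> v" "card (common_blue x y) < k + 1" for x y u v
  proof -
    have "k \<le> card (red_nbrs x \<union> red_nbrs y)" using card_union[of x y] that by simp
    then have "card (red_nbrs u) \<le> 5" "card (red_nbrs v) \<le> 5"
      using small_neighbourhood that by (auto simp: Y_def)
    then have "card (red_nbrs u \<union> red_nbrs v) \<le> 10" using card_Un_le[of "red_nbrs u" "red_nbrs v"] by simp
    \<comment> \<open>The bound \<open>11 \<le> k\<close> is exactly what gives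
      \<open>k + 1 \<le> 2 * k - 10\<close>.\<close>
    then show ?thesis using card_union[of u v] k_ge by simp
  qed
  have "\<exists>p q r. p \<in> Y \<and> q \<in> Y \<and> r \<in> Y \<and> distinct [p, q, r] \<and> k + 1 \<le> card (common_blue p q) \<and> k + 1 \<le> card (common_blue q r)"
  proof (cases "k + 1 \<le> card (common_blue a b)")
    case False
    then show ?thesis using small[of a b c d] small[of a b d e] dist sub
      by (intro exI[of _ c] exI[of _ d] exI[of _ e]) auto
  next
    case ab: True
    show ?thesis
    proof (cases "k + 1 \<le> card (common_blue b c)")
      case True
      then show ?thesis using ab dist sub
        by (intro exI[of _ a] exI[of _ b] exI[of _ c]) auto
    next
      case False
      then show ?thesis using small[of b c a d] small[of b c d e] dist sub
        by (intro exI[of _ a] exI[of _ d] exI[of _ e]) auto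
    qed
  qed
  then show ?thesis using blue_cycle_if_heavy_path unfolding Y_def by blast
qed

end

section \<open>Monochromatic cycles of every large even length\<close>

text \<open>Without a red cycle of length \<open>2 * k + 2\<close>, each pattern of the locale is
  excluded because it would produce one; the locale then supplies a blue cycle of that
  length.\<close>

lemma monochromatic_cycle_step:
  fixes R :: "'a \<Rightarrow> 'a \<Rightarrow> bool"
  assumes R_sym: "\<And>x y. R x y \<Longrightarrow> R y x" and V: "finite V" "3 * k + 2 \<le> card V" and k: "11 \<le> k"
    and us: "cyc R us" "set us \<subseteq> V" "length us = 2 * k"
  shows "\<exists>vs. set vs \<subseteq> V \<and> length vs = 2 * k + 2 \<and> (cyc R vs \<or> cyc (\<lambda>x y. \<not> R x y) vs)"
proof (rule ccontr)
  assume contra: "\<not> ?thesis"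
  then have no: False if "cyc R vs" "set vs \<subseteq> V" "length vs = 2 * k + 2" for vs using that by blast
  define C where "C = set us"
  have card_C: "card C = 2 * k" using us distinct_card[of us] by (simp add: C_def cyc_def)
  have "k + 2 \<le> card (V - C)" using V us card_C by (simp add: C_def card_Diff_subset)
  then obtain D where D: "D \<subseteq> V - C" "card D = k + 2" "finite D"
    by (metis obtain_subset_with_card_n)
  obtain \<sigma> where bij: "bij_betw \<sigma> C C" and
    split0: "\<And>p q. p \<in> C \<Longrightarrow> q \<in> C \<Longrightarrow> p \<noteq> q \<Longrightarrow>
      \<exists>ps qs. cyc R (ps @ qs) \<and> set (ps @ qs) = C \<and> ps \<noteq> [] \<and> qs \<noteq> [] \<and>
        last ps = p \<and> hd qs = \<sigma> p \<and> last qs = q \<and> hd ps = \<sigma> q"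
    using cyc_obtain_successor[OF us(1)] unfolding C_def by metis
  have split: "\<exists>ps qs. cyc R (ps @ qs) \<and> set (ps @ qs) = C \<and> length ps + length qs = 2 * k \<and>
      ps \<noteq> [] \<and> qs \<noteq> [] \<and> last ps = p \<and> hd qs = \<sigma> p \<and> last qs = q \<and> hd ps = \<sigma> q"
    if pq: "p \<in> C" "q \<in> C" "p \<noteq> q" for p q
  proof -
    obtain ps qs where l: "cyc R (ps @ qs)" "set (ps @ qs) = C" "ps \<noteq> []" "qs \<noteq> []"
      "last ps = p" "hd qs = \<sigma> p" "last qs = q" "hd ps = \<sigma> q" using split0[OF pq] by blast
    then have "length (ps @ qs) = 2 * k" using card_C distinct_card by (metis cyc_def)
    then show ?thesis using l by auto
  qed
  have CV: "C \<subseteq> V" and DV: "D \<subseteq> V" and disj: "C \<inter> D = {}" using us D by (auto simp: C_def)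
  have two: False
    if xy: "x \<in> D" "y \<in> D" "x \<noteq> y" and pq: "p \<in> C" "q \<in> C" "p \<noteq> q"
      and r: "R x p" "R x (\<sigma> p)" "R y q" "R y (\<sigma> q)" for x y p q
  proof -
    obtain ps qs where l: "cyc R (ps @ qs)" "set (ps @ qs) = C" "length ps + length qs = 2 * k"
      "ps \<noteq> []" "qs \<noteq> []" "last ps = p" "hd qs = \<sigma> p" "last qs = q" "hd ps = \<sigma> q"
      using split[OF pq] by blast
    have "x \<notin> C" "y \<notin> C" using xy disj by auto
    then have "cyc R (ps @ [x] @ qs @ [y])"
      using l r xy R_sym by (auto simp: cyc_def successively_append_iff successively_Cons)
    moreover have "set (ps @ [x] @ qs @ [y]) \<subseteq> V" using l CV DV xy by auto
    ultimately show False using no[of "ps @ [x] @ qs @ [y]"] l by simp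
  qed
  have cross: False
    if xy: "x \<in> D" "y \<in> D" "x \<noteq> y" and pq: "p \<in> C" "q \<in> C" "p \<noteq> q"
      and r: "R x p" "R x q" "R y (\<sigma> p)" "R y (\<sigma> q)" for x y p q
  proof -
    obtain ps qs where l: "cyc R (ps @ qs)" "set (ps @ qs) = C" "length ps + length qs = 2 * k"
      "ps \<noteq> []" "qs \<noteq> []" "last ps = p" "hd qs = \<sigma> p" "last qs = q" "hd ps = \<sigma> q"
      using split[OF pq] by blast
    have "x \<notin> C" "y \<notin> C" using xy disj by auto
    \<comment> \<open>The arc \<open>qs\<close> is traversed backwards: from \<open>p\<close>
      through \<open>x\<close> to \<open>q\<close>, back along the arc to \<open>\<sigma> p\<close>,
      and through \<open>y\<close> to \<open>\<sigma> q\<close>.\<close>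
    moreover have "successively (\<lambda>x y. R y x) qs"
      using l(1) R_sym by (auto simp: cyc_def successively_append_iff elim!: successively_mono)
    ultimately have "cyc R (ps @ [x] @ rev qs @ [y])"
      using l r xy R_sym
      by (auto simp: cyc_def successively_append_iff successively_Cons hd_rev last_rev)
    moreover have "set (ps @ [x] @ rev qs @ [y]) \<subseteq> V" using l CV DV xy by auto
    ultimately show False using no[of "ps @ [x] @ rev qs @ [y]"] l by simp
  qed
  have detour: False
    if xy: "x \<in> D" "y \<in> D" "z \<in> D" "x \<noteq> y" "y \<noteq> z" "x \<noteq> z" and pq: "p \<in> C"
      and r: "R x y" "R x z" "R y p" "R z (\<sigma> (\<sigma> p))" for x y z p
  proof -
    have sC: "\<sigma> p \<in> C" using bij pq by (auto simp: bij_betw_def)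
    \<comment> \<open>The cuts are made behind \<open>p\<close> and behind
      \<open>\<sigma> p\<close>, so these must differ; a fixed point would occur in both
      arcs.\<close>
    have "p \<noteq> \<sigma> p"
    proof
      assume fp: "p = \<sigma> p"
      have "\<exists>q\<in>C. q \<noteq> p"
      proof (rule ccontr)
        assume "\<not> ?thesis"
        then have "C \<subseteq> {p}" by blast
        then have "card C \<le> 1" using card_mono[of "{p}" C] by simp
        then show False using card_C k by simp
      qed
      then obtain q where "q \<in> C" "q \<noteq> p" by blast
      then obtain ps qs where "cyc R (ps @ qs)" "ps \<noteq> []" "qs \<noteq> []" "last ps = p" "hd qs = p"
        using split[of p q] pq fp by metis
      then show False by (metis cyc_def disjoint_iff distinct_append hd_in_set last_in_set)
    qed
    then obtain ps qs where l: "cyc R (ps @ qs)" "set (ps @ qs) = C" "length ps + length qs = 2 * k"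
      "ps \<noteq> []" "qs \<noteq> []" "last ps = p" "hd qs = \<sigma> p" "last qs = \<sigma> p" "hd ps = \<sigma> (\<sigma> p)"
      using split[OF pq sC] by blast
    \<comment> \<open>The second arc starts and ends at \<open>\<sigma> p\<close>, so it is this one
      vertex. Replacing it by \<open>y\<close>, \<open>x\<close>, \<open>z\<close> lengthens the
      cycle by two.\<close>
    have "length qs = 1"
    proof -
      have "qs ! 0 = qs ! (length qs - 1)" "distinct qs"
        using l by (auto simp: hd_conv_nth last_conv_nth cyc_def)
      then have "length qs \<le> 1" using \<open>qs \<noteq> []\<close> by (simp add: nth_eq_iff_index_eq)
      moreover have "length qs \<noteq> 0" using \<open>qs \<noteq> []\<close> by simp
      ultimately show ?thesis by linarith
    qed
    have "x \<notin> C" "y \<notin> C" "z \<notin> C" using xy disj by auto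
    then have "cyc R (ps @ [y, x, z])"
      using l r xy R_sym by (auto simp: cyc_def successively_append_iff successively_Cons)
    moreover have "set (ps @ [y, x, z]) \<subseteq> V" using l CV DV xy by auto
    ultimately show False using no[of "ps @ [y, x, z]"] l \<open>length qs = 1\<close> by simp
  qed
  define twice where "twice x \<longleftrightarrow> (\<exists>p q. p \<in> C \<and> q \<in> C \<and> p \<noteq> q \<and>
    R x p \<and> R x (\<sigma> p) \<and> R x q \<and> R x (\<sigma> q))" for x
  \<comment> \<open>If \<open>x0\<close> has two places, any place of another vertex can be combined
    with a different place of \<open>x0\<close>. If no vertex has two places, any element of
    \<open>D\<close> serves as \<open>x0\<close>.\<close>
  have "\<exists>x0\<in>D. \<forall>x\<in>D. x \<noteq> x0 \<longrightarrow> \<not> twice x"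
  proof (cases "\<exists>x0\<in>D. twice x0")
    case True
    then obtain x0 where x0: "x0 \<in> D" "twice x0" by blast
    have "\<not> twice x" if "x \<in> D" "x \<noteq> x0" for x
    proof
      assume "twice x"
      then obtain p where p: "p \<in> C" "R x p" "R x (\<sigma> p)" unfolding twice_def by blast
      obtain q where "q \<in> C" "q \<noteq> p" "R x0 q" "R x0 (\<sigma> q)" using x0(2) unfolding twice_def by metis
      then show False using two[of x x0 p q] p that x0(1) by blast
    qed
    then show ?thesis using x0 by blast
  next
    case False
    have "D \<noteq> {}" using D by auto
    then show ?thesis using False by blast
  qed
  then obtain x0 where x0: "x0 \<in> D" "\<And>x. x \<in> D \<Longrightarrow> x \<noteq> x0 \<Longrightarrow> \<not> twice x" by blast
  interpret red_cycle_and_outside R C D \<sigma> k x0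
  proof
    show "finite C" by (simp add: C_def)
    show False if "x \<in> D" "x \<noteq> x0" "p \<in> C" "q \<in> C" "p \<noteq> q"
      "R x p" "R x (\<sigma> p)" "R x q" "R x (\<sigma> q)" for x p q
      using x0(2)[of x] that unfolding twice_def by blast
  qed (fact R_sym card_C bij D disj k x0 two cross detour)+
  obtain vs where "set vs \<subseteq> C \<union> D" "length vs = 2 * k + 2" "cyc (\<lambda>x y. \<not> R x y) vs"
    using blue_cycle_exists unfolding blue_cycle_def by blast
  moreover have "C \<union> D \<subseteq> V" using CV DV by blast
  ultimately show False using contra by (meson subset_trans)
qed

lemma cyc_of_distinct:
  assumes "distinct xs" "2 \<le> length xs" "\<And>x y. x \<in> set xs \<Longrightarrow> y \<in> set xs \<Longrightarrow> x \<noteq> y \<Longrightarrow> P x y"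
  shows "cyc P xs"
proof -
  obtain x ys where "xs = x # ys" "ys \<noteq> []"
    using assms(2) by (cases xs; cases "tl xs") auto
  then have "xs \<noteq> []" "last xs \<noteq> hd xs"
    using assms(1) last_in_set[of ys] by auto
  moreover have "successively P xs"
    unfolding successively_conv_nth using assms by (auto simp: nth_eq_iff_index_eq)
  ultimately show ?thesis using assms by (auto simp: cyc_def)
qed

text \<open>Ramsey's theorem gives a cycle of length \<open>22 = 2 * 11\<close>, which is lengthened
  within the same \<open>V\<close>. The step from \<open>k\<close> to \<open>k + 1\<close> needs
  \<open>3 * k + 2 = 3 * (k + 1) - 1\<close> vertices, at most \<open>3 * t - 1\<close>. The summand
  \<open>r\<close> in the threshold ensures \<open>r \<le> card V\<close>.\<close>

theorem monochromatic_even_cycle: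
  shows "\<exists>t0. \<forall>t\<ge>t0. \<forall>R (V :: 'a set). symp R \<longrightarrow> finite V \<longrightarrow> 3 * t - 1 \<le> card V \<longrightarrow>
    (\<exists>vs. set vs \<subseteq> V \<and> length vs = 2 * t \<and> (cyc R vs \<or> cyc (\<lambda>x y. \<not> R x y) vs))"
proof -
  obtain r where r: "\<And>(V :: 'a set) E. finite V \<Longrightarrow> r \<le> card V \<Longrightarrow>
      \<exists>K \<subseteq> V. card K = 22 \<and> clique K E \<or> card K = 22 \<and> indep K E"
    using ramsey2[of 22 22] by metis
  have "\<exists>vs. set vs \<subseteq> V \<and> length vs = 2 * t \<and> (cyc R vs \<or> cyc (\<lambda>x y. \<not> R x y) vs)"
    if t: "r + 11 \<le> t" and R: "symp R" and V: "finite V" "3 * t - 1 \<le> card V" for t and R and V :: "'a set"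
  proof -
    have sym: "R x y \<Longrightarrow> R y x" for x y using R by (auto dest: sympD)
    have "\<exists>vs. set vs \<subseteq> V \<and> length vs = 2 * k \<and> (cyc R vs \<or> cyc (\<lambda>x y. \<not> R x y) vs)"
      if "11 \<le> k" "k \<le> t" for k
      using that
    proof (induction k rule: dec_induct)
      case base
      have "r \<le> card V" using V t by linarith
      then obtain K where K: "K \<subseteq> V" "card K = 22"
        "clique K {{x, y} |x y. R x y} \<or> indep K {{x, y} |x y. R x y}"
        using r[of V "{{x, y} |x y. R x y}"] V by blast
      have "finite K" using K V finite_subset by blast
      then obtain vs where vs: "set vs = K" "distinct vs" using finite_distinct_list by blast
      have len: "length vs = 22" using vs K distinct_card by metis
      have "{x, y} \<in> {{x, y} |x y. R x y} \<longleftrightarrow> R x y" for x y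
        using sym by (auto simp: doubleton_eq_iff)
      then have "(\<forall>x\<in>K. \<forall>y\<in>K. x \<noteq> y \<longrightarrow> R x y) \<or> (\<forall>x\<in>K. \<forall>y\<in>K. x \<noteq> y \<longrightarrow> \<not> R x y)"
        using K(3) unfolding clique_def indep_def by simp
      then have "cyc R vs \<or> cyc (\<lambda>x y. \<not> R x y) vs"
        using cyc_of_distinct[of vs] vs len by auto
      then show ?case using vs K len by auto
    next
      case (step k)
      then obtain vs where vs: "set vs \<subseteq> V" "length vs = 2 * k"
        "cyc R vs \<or> cyc (\<lambda>x y. \<not> R x y) vs" by auto
      have c: "3 * k + 2 \<le> card V" using V step by simp
      from vs(3) have "\<exists>ws. set ws \<subseteq> V \<and> length ws = 2 * k + 2 \<and>
        (cyc R ws \<or> cyc (\<lambda>x y. \<not> R x y) ws)"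
      proof
        assume "cyc R vs"
        then show ?thesis
          using monochromatic_cycle_step[of R V k vs] sym V c vs step by blast
      next
        assume "cyc (\<lambda>x y. \<not> R x y) vs"
        moreover have "\<not> R y x" if "\<not> R x y" for x y using sym that by blast
        ultimately show ?thesis
          using monochromatic_cycle_step[of "\<lambda>x y. \<not> R x y" V k vs] V c vs(1,2) step(1)
          unfolding not_not by blast
      qed
      then show ?case by simp
    qed
    then show ?thesis using t by simp
  qed
  then show ?thesis by blast
qed

section \<open>Copies of cycles\<close>

definition cycle_edges :: "'a list \<Rightarrow> 'a set set" where
  "cycle_edges xs = (\<lambda>i. {xs ! i, xs ! (Suc i mod length xs)}) ` {..<length xs}"

lemma copies_cycleI:
  assumes "distinct xs" "length xs = n" "set xs \<subseteq> fst G" "cycle_edges xs \<subseteq> snd G"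
  shows "(set xs, cycle_edges xs) \<in> copies (cycle_graph n) G"
proof -
  have "bij_betw ((!) xs) {..<n} (set xs)"
    using assms by (intro bij_betw_nth) auto
  moreover have "cycle_edges xs = (\<lambda>e. (!) xs ` e) ` {{i, Suc i mod n} |i. i < n}"
    using assms(2) unfolding cycle_edges_def by (auto simp: image_iff) (metis image_insert image_empty)
  ultimately show ?thesis
    using assms by (auto simp: copies_def graph_iso_def cycle_graph_def)
qed

lemma copies_cycleE:
  assumes "(W, F) \<in> copies (cycle_graph n) G"
  obtains xs where "distinct xs" "length xs = n" "set xs = W" "F = cycle_edges xs"
    "W \<subseteq> fst G" "F \<subseteq> snd G"
proof -
  from assms obtain f where f: "bij_betw f {..<n} W" "F = (\<lambda>e. f ` e) ` {{i, Suc i mod n} |i. i < n}"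
    and sub: "W \<subseteq> fst G" "F \<subseteq> snd G"
    by (auto simp: copies_def graph_iso_def cycle_graph_def)
  define xs where "xs = map f [0..<n]"
  have "distinct xs" "length xs = n" "set xs = W"
    using f(1) by (auto simp: xs_def distinct_map bij_betw_def lessThan_atLeast0)
  moreover have "F = cycle_edges xs"
  proof -
    have "{{i, Suc i mod n} |i. i < n} = (\<lambda>i. {i, Suc i mod n}) ` {..<n}" by auto
    then have "F = (\<lambda>i. {f i, f (Suc i mod n)}) ` {..<n}"
      unfolding f(2) by (simp add: image_image)
    also have "\<dots> = cycle_edges xs"
      unfolding cycle_edges_def by (intro image_cong) (auto simp: xs_def)
    finally show ?thesis .
  qed
  ultimately show thesis using that sub by blast
qed

lemma bij_betw_Suc_mod: "bij_betw (\<lambda>i. Suc i mod n) {..<n} {..<n}"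
proof -
  have "{..<n} \<subseteq> (\<lambda>i. Suc i mod n) ` {..<n}"
  proof
    fix j assume j: "j \<in> {..<n}"
    show "j \<in> (\<lambda>i. Suc i mod n) ` {..<n}"
    proof (cases j)
      case 0
      then show ?thesis using j by (intro image_eqI[of _ _ "n - 1"]) auto
    next
      case (Suc i)
      then show ?thesis using j by (intro image_eqI[of _ _ i]) auto
    qed
  qed
  then have "(\<lambda>i. Suc i mod n) ` {..<n} = {..<n}" by auto
  then show ?thesis by (simp add: bij_betw_def eq_card_imp_inj_on)
qed

lemma cycle_edges_rotate1: "cycle_edges (rotate1 xs) = cycle_edges xs"
proof -
  let ?s = "\<lambda>i. Suc i mod length xs"
  have "cycle_edges (rotate1 xs) = (\<lambda>i. {xs ! ?s i, xs ! ?s (?s i)}) ` {..<length xs}"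
    unfolding cycle_edges_def length_rotate1
  proof (intro image_cong refl)
    fix i assume "i \<in> {..<length xs}"
    then have "i < length xs" by simp
    moreover from this have "?s i < length xs" by (intro mod_less_divisor) linarith
    ultimately
    show "{rotate1 xs ! i, rotate1 xs ! ?s i} = {xs ! ?s i, xs ! ?s (?s i)}"
      by (simp add: nth_rotate1)
  qed
  also have "\<dots> = (\<lambda>i. {xs ! i, xs ! ?s i}) ` ?s ` {..<length xs}"
    by (simp add: image_image)
  also have "?s ` {..<length xs} = {..<length xs}"
    using bij_betw_Suc_mod by (auto simp: bij_betw_def)
  finally show ?thesis by (simp add: cycle_edges_def)
qed

lemma cycle_edges_rotate: "cycle_edges (rotate m xs) = cycle_edges xs"
  by (induction m) (simp_all add: cycle_edges_rotate1)

text \<open>Listing a cycle from a prescribed vertex saves the factor \<open>length xs\<close> when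
  cycles are counted through lists.\<close>

lemma obtain_rotation:
  assumes "distinct xs" "w \<in> set xs"
  obtains ys where "distinct (w # ys)" "length (w # ys) = length xs" "set (w # ys) = set xs"
    "cycle_edges (w # ys) = cycle_edges xs"
proof -
  obtain us vs where xs: "xs = us @ w # vs" using assms(2) by (meson split_list)
  then have "rotate (length us) xs = w # (vs @ us)" by (simp add: rotate_append)
  then show thesis
    using that[of "vs @ us"] assms(1) cycle_edges_rotate[of "length us" xs] xs by auto
qed

lemma cyc_nth:
  assumes "cyc P xs" "i < length xs"
  shows "P (xs ! i) (xs ! (Suc i mod length xs))"
proof (cases "Suc i < length xs")
  case True
  then show ?thesis using assms by (auto simp: cyc_def successively_conv_nth)
next
  case False
  then have "Suc i = length xs" "i = length xs - 1" using assms by auto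
  moreover have "P (last xs) (hd xs)" "xs \<noteq> []" using assms by (simp_all add: cyc_def)
  ultimately show ?thesis by (simp add: hd_conv_nth last_conv_nth)
qed

lemma distinct_Suc_mod:
  assumes "distinct xs" "2 \<le> length xs" "i < length xs"
  shows "xs ! i \<noteq> xs ! (Suc i mod length xs)"
proof -
  have "Suc i mod length xs \<noteq> i" "Suc i mod length xs < length xs"
    using assms by (cases "Suc i = length xs"; auto)+
  then show ?thesis using assms by (auto simp: nth_eq_iff_index_eq)
qed

lemma copies_colour_class_nonempty:
  assumes "cyc (\<lambda>x y. c {x, y} = a) xs" "2 \<le> length xs" "set xs \<subseteq> {..<N}"
  shows "copies (cycle_graph (length xs)) (colour_class N c a) \<noteq> {}"
proof -
  have "{xs ! i, xs ! (Suc i mod length xs)} \<in> {e \<in> nsets {..<N} 2. c e = a}"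
    if "i < length xs" for i
  proof -
    have "Suc i mod length xs < length xs" using that by (intro mod_less_divisor) linarith
    then have "xs ! i \<in> {..<N}" "xs ! (Suc i mod length xs) \<in> {..<N}"
      using that assms(3) nth_mem by blast+
    then show ?thesis
      using cyc_nth[OF assms(1) that] distinct_Suc_mod[OF _ assms(2) that] assms
      by (auto simp: cyc_def)
  qed
  then have "cycle_edges xs \<subseteq> {e \<in> nsets {..<N} 2. c e = a}"
    unfolding cycle_edges_def by blast
  then have "(set xs, cycle_edges xs) \<in> copies (cycle_graph (length xs)) (colour_class N c a)"
    using assms by (intro copies_cycleI) (auto simp: cyc_def colour_class_def)
  then show ?thesis by blast
qed

section \<open>The Ramsey number of an even cycle\<close>

theorem ramsey_number_even_cycle_le:
  "\<exists>t0. \<forall>t\<ge>t0. ramsey_number (cycle_graph (2 * t)) \<le> 3 * t - 1"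
proof -
  obtain t0 where t0: "\<And>t R V. \<lbrakk>t \<ge> t0; symp R; finite (V :: nat set); 3 * t - 1 \<le> card V\<rbrakk> \<Longrightarrow>
      \<exists>vs. set vs \<subseteq> V \<and> length vs = 2 * t \<and> (cyc R vs \<or> cyc (\<lambda>x y. \<not> R x y) vs)"
    using monochromatic_even_cycle by metis
  have "ramsey_number (cycle_graph (2 * t)) \<le> 3 * t - 1" if t: "max 1 t0 \<le> t" for t
    unfolding ramsey_number_def
  proof (rule Least_le, intro conjI allI)
    show "0 < 3 * t - 1" using t by simp
    fix c :: "nat set \<Rightarrow> colour"
    \<comment> \<open>The value of \<open>R x x\<close> is arbitrary, which is harmless because
      consecutive vertices of the cycle are distinct.\<close>
    define R where "R x y \<longleftrightarrow> c {x, y} = Red" for x y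
    have "symp R" by (auto simp: symp_def R_def insert_commute)
    then obtain vs where vs: "set vs \<subseteq> {..<3 * t - 1}" "length vs = 2 * t"
      "cyc R vs \<or> cyc (\<lambda>x y. \<not> R x y) vs"
      using t0[of t R "{..<3 * t - 1}"] t by auto
    have "(\<lambda>x y. \<not> R x y) = (\<lambda>x y. c {x, y} = Blue)"
      by (intro ext) (metis R_def colour.exhaust colour.distinct(1))
    then obtain a where "cyc (\<lambda>x y. c {x, y} = a) vs" using vs(3) unfolding R_def by metis
    then show "\<exists>a. copies (cycle_graph (2 * t)) (colour_class (3 * t - 1) c a) \<noteq> {}"
      using copies_colour_class_nonempty[of c a vs "3 * t - 1"] vs t by auto
  qed
  then show ?thesis by blast
qed

lemma finite_copies:
  assumes "finite V" "finite E"
  shows "finite (copies H (V, E))"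
  by (rule finite_subset[of _ "Pow V \<times> Pow E"]) (use assms in \<open>auto simp: copies_def\<close>)

lemma finite_copies_colour_class: "finite (copies H (colour_class n c a))"
  unfolding colour_class_def by (intro finite_copies) (simp_all add: finite_imp_finite_nsets)

lemma threshold_ramsey_multiplicity_le:
  assumes "ramsey_number H \<le> n"
  shows "threshold_ramsey_multiplicity H \<le> mono_count H n c"
proof -
  have "threshold_ramsey_multiplicity H \<le> mono_count H (ramsey_number H) c"
    unfolding threshold_ramsey_multiplicity_def by (rule Least_le) blast
  also have "\<dots> \<le> mono_count H n c"
    unfolding mono_count_def
  proof -
    have "copies H (colour_class (ramsey_number H) c a) \<subseteq> copies H (colour_class n c a)" for a
      using assms nsets_mono[of "{..<ramsey_number H}" "{..<n}" 2]
      by (fastforce simp: copies_def colour_class_def)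
    then show "card (copies H (colour_class (ramsey_number H) c Red)) +
        card (copies H (colour_class (ramsey_number H) c Blue))
      \<le> card (copies H (colour_class n c Red)) + card (copies H (colour_class n c Blue))"
      by (intro add_mono card_mono finite_copies_colour_class)
  qed
  finally show ?thesis .
qed

section \<open>The random colouring\<close>

text \<open>Equal edges at different positions would make each position the cyclic successor of the
  other, which forces length 2.\<close>

lemma inj_on_cycle_edges:
  assumes "distinct xs" "3 \<le> length xs"
  shows "inj_on (\<lambda>i. {xs ! i, xs ! (Suc i mod length xs)}) {..<length xs}"
proof (rule inj_onI)
  let ?n = "length xs"
  fix i j assume ij: "i \<in> {..<?n}" "j \<in> {..<?n}"
    and eq: "{xs ! i, xs ! (Suc i mod ?n)} = {xs ! j, xs ! (Suc j mod ?n)}"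
  have lt: "Suc i mod ?n < ?n" "Suc j mod ?n < ?n" using assms(2) by (auto intro!: mod_less_divisor)
  show "i = j"
  proof (rule ccontr)
    assume "i \<noteq> j"
    then have "i = Suc j mod ?n" "j = Suc i mod ?n"
      using eq ij lt assms(1) by (auto simp: doubleton_eq_iff nth_eq_iff_index_eq)
    moreover have "i mod ?n = i" "j mod ?n = j" using ij by auto
    ultimately show False using assms(2) by (simp add: mod_Suc split: if_splits)
  qed
qed

text \<open>Every vertex of the cycle in \<open>I\<close> lies on two cycle edges, and no edge is
  counted twice since none has both ends in \<open>I\<close>. \<open>J\<close> collects the edges by
  their first end, \<open>J'\<close> by their second.\<close>

lemma independent_set_in_cycle:
  assumes xs: "distinct xs" "3 \<le> length xs" and ind: "\<And>e. e \<in> cycle_edges xs \<Longrightarrow> \<not> e \<subseteq> I"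
  shows "2 * card (set xs \<inter> I) \<le> card {e \<in> cycle_edges xs. e \<inter> I \<noteq> {}}"
proof -
  let ?n = "length xs"
  let ?s = "\<lambda>i. Suc i mod ?n"
  define J where "J = {i. i < ?n \<and> xs ! i \<in> I}"
  define J' where "J' = {i. i < ?n \<and> xs ! ?s i \<in> I}"
  have fin: "finite J" "finite J'" by (auto simp: J_def J'_def)
  have "card (set xs \<inter> I) = card J"
  proof -
    have "set xs \<inter> I = (!) xs ` J" by (auto simp: J_def in_set_conv_nth)
    moreover have "inj_on ((!) xs) J" using xs by (auto simp: J_def inj_on_def nth_eq_iff_index_eq)
    ultimately show ?thesis by (simp add: card_image)
  qed
  moreover have "card J' = card J"
  proof -
    have sb: "bij_betw ?s {..<?n} {..<?n}" by (rule bij_betw_Suc_mod)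
    have "?s ` J' = J"
    proof
      show "?s ` J' \<subseteq> J" using sb by (auto simp: J_def J'_def bij_betw_def)
      show "J \<subseteq> ?s ` J'"
      proof
        fix j assume j: "j \<in> J"
        then obtain i where "i < ?n" "j = ?s i" using sb by (auto simp: J_def bij_betw_def)
        then show "j \<in> ?s ` J'" using j by (auto simp: J_def J'_def)
      qed
    qed
    moreover have "inj_on ?s J'" using sb by (auto simp: bij_betw_def J'_def intro: inj_on_subset)
    ultimately show ?thesis by (metis card_image)
  qed
  moreover have "J \<inter> J' = {}"
  proof -
    have False if i: "i < ?n" "xs ! i \<in> I" "xs ! ?s i \<in> I" for i
      using ind[of "{xs ! i, xs ! ?s i}"] i by (auto simp: cycle_edges_def)
    then show ?thesis by (auto simp: J_def J'_def)
  qed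
  moreover have "card (J \<union> J') \<le> card {e \<in> cycle_edges xs. e \<inter> I \<noteq> {}}"
  proof (rule card_inj_on_le)
    show "inj_on (\<lambda>i. {xs ! i, xs ! ?s i}) (J \<union> J')"
      by (rule inj_on_subset[OF inj_on_cycle_edges[OF xs]]) (auto simp: J_def J'_def)
    show "(\<lambda>i. {xs ! i, xs ! ?s i}) ` (J \<union> J') \<subseteq> {e \<in> cycle_edges xs. e \<inter> I \<noteq> {}}"
      by (auto simp: J_def J'_def cycle_edges_def)
    show "finite {e \<in> cycle_edges xs. e \<inter> I \<noteq> {}}" by (simp add: cycle_edges_def)
  qed
  ultimately show ?thesis using card_Un_disjoint[OF fin] by simp
qed

lemma card_cycle_edges_le: "card (cycle_edges xs) \<le> length xs"
  unfolding cycle_edges_def by (metis card_image_le card_lessThan finite_lessThan)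

text \<open>A cycle is determined by the order of the other vertices after a fixed \<open>w\<close>.
  Both directions are counted; this factor 2 is absorbed into the \<open>o(1)\<close> of the
  exponent.\<close>

lemma card_cycles_on_le:
  assumes "finite W" "W \<noteq> {}"
  shows "finite {cycle_edges xs |xs. distinct xs \<and> set xs = W}"
    "card {cycle_edges xs |xs. distinct xs \<and> set xs = W} \<le> fact (card W - 1)"
proof -
  obtain w where w: "w \<in> W" using assms by blast
  have fin: "finite (permutations_of_set (W - {w}))" by simp
  have sub: "{cycle_edges xs |xs. distinct xs \<and> set xs = W}
      \<subseteq> (\<lambda>ys. cycle_edges (w # ys)) ` permutations_of_set (W - {w})"
  proof
    fix F assume "F \<in> {cycle_edges xs |xs. distinct xs \<and> set xs = W}"
    then obtain xs where xs: "distinct xs" "set xs = W" "F = cycle_edges xs" by blast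
    then obtain ys where "distinct (w # ys)" "set (w # ys) = W" "cycle_edges (w # ys) = F"
      using obtain_rotation[of xs w] w by metis
    then show "F \<in> (\<lambda>ys. cycle_edges (w # ys)) ` permutations_of_set (W - {w})"
      by (auto simp: permutations_of_set_def intro!: image_eqI[of _ _ ys])
  qed
  show "finite {cycle_edges xs |xs. distinct xs \<and> set xs = W}"
    using sub fin finite_subset by blast
  have "card {cycle_edges xs |xs. distinct xs \<and> set xs = W} \<le> card (permutations_of_set (W - {w}))"
    using surj_card_le[OF fin sub] .
  also have "\<dots> = fact (card W - 1)" using assms w by simp
  finally show "card {cycle_edges xs |xs. distinct xs \<and> set xs = W} \<le> fact (card W - 1)" .
qed

section \<open>Random subsets and the first moment\<close>

text \<open>The weights are the law of a random \<open>S\<close> containing each element of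
  \<open>M\<close> independently with probability \<open>p\<close>. The sums are the probabilities
  that \<open>S\<close> contains \<open>F\<close> and that it avoids \<open>F\<close>.\<close>

lemma sum_random_subset:
  fixes p :: real
  assumes "finite M" "F \<subseteq> M"
  shows "(\<Sum>S\<in>Pow M. p ^ card S * (1 - p) ^ card (M - S) * of_bool (F \<subseteq> S)) = p ^ card F"
    and "(\<Sum>S\<in>Pow M. p ^ card S * (1 - p) ^ card (M - S) * of_bool (F \<inter> S = {})) = (1 - p) ^ card F"
proof -
  have zero: "(\<Prod>e\<in>X. if e \<in> F then 0 else q) = q ^ card X * of_bool (F \<inter> X = {})"
    if "finite X" for q :: real and X
  proof (cases "F \<inter> X = {}")
    case True
    then have "(\<Prod>e\<in>X. if e \<in> F then 0 else q) = (\<Prod>e\<in>X. q)" by (intro prod.cong) auto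
    then show ?thesis using True by simp
  next
    case False
    then show ?thesis using that by (auto intro!: prod_zero)
  qed
  have one: "(\<Prod>e\<in>M. if e \<in> F then q else 1) = q ^ card F" for q :: real
  proof -
    have "(\<Prod>e\<in>M. if e \<in> F then q else 1) = (\<Prod>e\<in>F. q)"
      using assms by (subst prod.inter_filter[symmetric]) (auto intro!: arg_cong[where f = "\<lambda>X. q ^ card X"])
    then show ?thesis by simp
  qed
  have fin: "finite S" if "S \<in> Pow M" for S using assms that finite_subset by auto
  \<comment> \<open>The factor of \<open>e\<close> is \<open>p\<close> on \<open>F\<close> and
    \<open>p + (1 - p)\<close> elsewhere; expanding the product produces one summand for each
    \<open>S\<close>.\<close>
  have "p ^ card F = (\<Prod>e\<in>M. p + (if e \<in> F then 0 else 1 - p))"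
    unfolding one[symmetric] by (intro prod.cong) auto
  also have "\<dots> = (\<Sum>S\<in>Pow M. (\<Prod>e\<in>S. p) * (\<Prod>e\<in>M - S. if e \<in> F then 0 else 1 - p))"
    by (rule prod_add) fact
  also have "\<dots> = (\<Sum>S\<in>Pow M. p ^ card S * (1 - p) ^ card (M - S) * of_bool (F \<subseteq> S))"
  proof (intro sum.cong refl)
    fix S assume S: "S \<in> Pow M"
    have "F \<inter> (M - S) = {} \<longleftrightarrow> F \<subseteq> S" using assms by blast
    then show "(\<Prod>e\<in>S. p) * (\<Prod>e\<in>M - S. if e \<in> F then 0 else 1 - p)
        = p ^ card S * (1 - p) ^ card (M - S) * of_bool (F \<subseteq> S)"
      using zero[of "M - S" "1 - p"] assms by simp
  qed
  finally show "(\<Sum>S\<in>Pow M. p ^ card S * (1 - p) ^ card (M - S) * of_bool (F \<subseteq> S)) = p ^ card F" ..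
  have "(1 - p) ^ card F = (\<Prod>e\<in>M. (if e \<in> F then 0 else p) + (1 - p))"
    unfolding one[symmetric] by (intro prod.cong) auto
  also have "\<dots> = (\<Sum>S\<in>Pow M. (\<Prod>e\<in>S. if e \<in> F then 0 else p) * (\<Prod>e\<in>M - S. 1 - p))"
    by (rule prod_add) fact
  also have "\<dots> = (\<Sum>S\<in>Pow M. p ^ card S * (1 - p) ^ card (M - S) * of_bool (F \<inter> S = {}))"
    by (intro sum.cong refl) (simp add: zero[OF fin] mult_ac)
  finally show "(\<Sum>S\<in>Pow M. p ^ card S * (1 - p) ^ card (M - S) * of_bool (F \<inter> S = {}))
      = (1 - p) ^ card F" ..
qed

text \<open>The right-hand side is the expectation of the count on the left, and some outcome does
  not exceed it. Later \<open>f x\<close> is the set of randomly coloured edges of a candidate copy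
  \<open>x\<close>.\<close>

lemma exists_subset_le_expectation:
  fixes p :: real
  assumes p: "0 \<le> p" "p \<le> 1" and fin: "finite M" "finite P" "finite Q"
    and sub: "\<And>x. x \<in> P \<union> Q \<Longrightarrow> f x \<subseteq> M"
  shows "\<exists>S\<subseteq>M. real (card {x \<in> P. f x \<subseteq> S} + card {x \<in> Q. f x \<inter> S = {}})
    \<le> (\<Sum>x\<in>P. p ^ card (f x)) + (\<Sum>x\<in>Q. (1 - p) ^ card (f x))"
proof (rule ccontr)
  define w where "w S = p ^ card S * (1 - p) ^ card (M - S)" for S
  define X where "X S = real (card {x \<in> P. f x \<subseteq> S} + card {x \<in> Q. f x \<inter> S = {}})" for S
  define E where "E = (\<Sum>x\<in>P. p ^ card (f x)) + (\<Sum>x\<in>Q. (1 - p) ^ card (f x))"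
  assume "\<not> ?thesis"
  then have gt: "E < X S" if "S \<in> Pow M" for S
    using that by (auto simp: not_le X_def E_def)
  have w0: "0 \<le> w S" for S using p by (simp add: w_def)
  have w1: "(\<Sum>S\<in>Pow M. w S) = 1"
    using sum_random_subset(1)[of M "{}" p] fin by (simp add: w_def)
  have X_sum: "X S = (\<Sum>x\<in>P. of_bool (f x \<subseteq> S)) + (\<Sum>x\<in>Q. of_bool (f x \<inter> S = {}))" for S
    using fin by (simp add: X_def Int_def)
  have "(\<Sum>S\<in>Pow M. w S * X S) = (\<Sum>x\<in>P. \<Sum>S\<in>Pow M. w S * of_bool (f x \<subseteq> S))
      + (\<Sum>x\<in>Q. \<Sum>S\<in>Pow M. w S * of_bool (f x \<inter> S = {}))"
    unfolding X_sum ring_distribs sum.distrib sum_distrib_left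
    by (intro arg_cong2[where f = "(+)"] sum.swap)
  also have "\<dots> = E"
    unfolding E_def w_def using sub fin
    by (intro arg_cong2[where f = "(+)"] sum.cong refl sum_random_subset) auto
  finally have "(\<Sum>S\<in>Pow M. w S * X S) = (\<Sum>S\<in>Pow M. w S * E)"
    using w1 by (simp flip: sum_distrib_right)
  \<comment> \<open>Single weights may vanish when \<open>p\<close> is 0 or 1, so the contradiction
    is drawn from the total: all weights would be zero, although they sum to 1.\<close>
  then have "(\<Sum>S\<in>Pow M. w S * (X S - E)) = 0"
    by (simp add: right_diff_distrib sum_subtractf)
  moreover have "0 \<le> w S * (X S - E)" if "S \<in> Pow M" for S
    using w0[of S] gt[OF that] by simp
  ultimately have "\<forall>S\<in>Pow M. w S * (X S - E) = 0"
    using fin by (subst (asm) sum_nonneg_eq_0_iff) auto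
  then have "w S = 0" if "S \<in> Pow M" for S using gt[OF that] that by auto
  then have "(\<Sum>S\<in>Pow M. w S) = 0" by (intro sum.neutral) blast
  then show False using w1 by simp
qed

section \<open>Copies that can be monochromatic in the two-part colouring\<close>

locale two_parts =
  fixes t :: nat and A B :: "nat set"
  assumes t_ge: "2 \<le> t" and disj: "A \<inter> B = {}" and Un: "A \<union> B = {..<3 * t - 1}"
    and card_A: "card A = 2 * t - 1" and card_B: "card B = t"
begin

definition cycle_copies :: "nat sgraph set" where
  "cycle_copies = copies (cycle_graph (2 * t)) (A \<union> B, nsets (A \<union> B) 2)"
text \<open>Edges inside \<open>B\<close> are always blue and edges inside \<open>A\<close> always
  red, so only these copies can become red, and only the next ones blue.\<close>

definition red_candidates :: "nat sgraph set" where "red_candidates = {x \<in> cycle_copies. \<forall>e\<in>snd x. \<not> e \<subseteq> B}"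
definition blue_candidates :: "nat sgraph set" where "blue_candidates = {x \<in> cycle_copies. \<forall>e\<in>snd x. \<not> e \<subseteq> A}"
definition cross_edges :: "nat set set" where "cross_edges = {e \<in> nsets (A \<union> B) 2. \<not> e \<subseteq> A \<and> \<not> e \<subseteq> B}"

definition colouring :: "nat set set \<Rightarrow> nat set \<Rightarrow> colour" where
  "colouring S e = (if e \<subseteq> A then Red else if e \<subseteq> B then Blue else if e \<in> S then Red else Blue)"

lemma finite_A: "finite A" and finite_B: "finite B"
  using Un by (metis finite_Un finite_lessThan)+

lemma finite_cross_edges: "finite cross_edges"
  unfolding cross_edges_def using finite_A finite_B by (simp add: finite_imp_finite_nsets)

lemma finite_cycle_copies: "finite cycle_copies"
  unfolding cycle_copies_def using finite_A finite_B by (intro finite_copies finite_imp_finite_nsets) auto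

lemma finite_red_candidates: "finite red_candidates" and finite_blue_candidates: "finite blue_candidates"
  using finite_cycle_copies by (auto simp: red_candidates_def blue_candidates_def)

lemma cycle_copiesE:
  assumes "x \<in> cycle_copies"
  obtains xs where "distinct xs" "length xs = 2 * t" "set xs = fst x" "snd x = cycle_edges xs"
    "fst x \<subseteq> A \<union> B" "snd x \<subseteq> nsets (A \<union> B) 2" "card (fst x) = 2 * t" "finite (fst x)"
proof -
  obtain W F where x: "x = (W, F)" by force
  then obtain xs where "distinct xs" "length xs = 2 * t" "set xs = W" "F = cycle_edges xs"
    "W \<subseteq> A \<union> B" "F \<subseteq> nsets (A \<union> B) 2"
    using assms copies_cycleE[of W F "2 * t" "(A \<union> B, nsets (A \<union> B) 2)"]
    unfolding cycle_copies_def by (metis fst_conv snd_conv)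
  then show thesis using that x distinct_card[of xs] by auto
qed

text \<open>An edge that meets the part \<open>I\<close> without lying inside it joins the two
  parts, so \<open>independent_set_in_cycle\<close> applies.\<close>

lemma card_crossing_edges:
  assumes x: "x \<in> cycle_copies" and I: "I = A \<or> I = B" and ind: "\<forall>e\<in>snd x. \<not> e \<subseteq> I"
  shows "2 * card (fst x \<inter> I) \<le> card (snd x \<inter> cross_edges)" "card (snd x) \<le> 2 * t"
proof -
  obtain xs where xs: "distinct xs" "length xs = 2 * t" "set xs = fst x" "snd x = cycle_edges xs"
    "snd x \<subseteq> nsets (A \<union> B) 2" using cycle_copiesE[OF x] by metis
  have "{e \<in> cycle_edges xs. e \<inter> I \<noteq> {}} \<subseteq> snd x \<inter> cross_edges"
    using xs ind I disj by (auto simp: cross_edges_def)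
  then have "card {e \<in> cycle_edges xs. e \<inter> I \<noteq> {}} \<le> card (snd x \<inter> cross_edges)"
    using finite_cross_edges by (intro card_mono) auto
  then show "2 * card (fst x \<inter> I) \<le> card (snd x \<inter> cross_edges)"
    using independent_set_in_cycle[of xs I] xs ind t_ge by auto
  show "card (snd x) \<le> 2 * t" using card_cycle_edges_le[of xs] xs by simp
qed

lemma finite_snd: "x \<in> cycle_copies \<Longrightarrow> finite (snd x)"
  by (erule cycle_copiesE) (simp add: cycle_edges_def)

lemma mono_count_le:
  "mono_count (cycle_graph (2 * t)) (3 * t - 1) (colouring S)
    \<le> card {x \<in> red_candidates. snd x \<inter> cross_edges \<subseteq> S} + card {x \<in> blue_candidates. snd x \<inter> cross_edges \<inter> S = {}}"
proof -
  have sub: "copies (cycle_graph (2 * t)) (colour_class (3 * t - 1) (colouring S) a) \<subseteq>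
     {x \<in> cycle_copies. \<forall>e\<in>snd x. colouring S e = a}" for a
    by (auto simp: cycle_copies_def copies_def colour_class_def Un)
  \<comment> \<open>The empty set would lie in both parts and be coloured red while contained in
    \<open>B\<close>.\<close>
  have nonempty: "e \<noteq> {}" if "x \<in> cycle_copies" "e \<in> snd x" for x e
    using that by (auto elim!: cycle_copiesE simp: nsets_def)
  have "{x \<in> cycle_copies. \<forall>e\<in>snd x. colouring S e = Red} \<subseteq> {x \<in> red_candidates. snd x \<inter> cross_edges \<subseteq> S}"
    using disj nonempty by (fastforce simp: red_candidates_def cross_edges_def colouring_def split: if_splits)
  moreover have "{x \<in> cycle_copies. \<forall>e\<in>snd x. colouring S e = Blue} \<subseteq> {x \<in> blue_candidates. snd x \<inter> cross_edges \<inter> S = {}}"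
    by (fastforce simp: blue_candidates_def cross_edges_def colouring_def split: if_splits)
  ultimately show ?thesis
    unfolding mono_count_def using sub[of Red] sub[of Blue] finite_red_candidates finite_blue_candidates
    by (intro add_mono card_mono) auto
qed

text \<open>\<open>A\<close> has only \<open>2 * t - 1\<close> vertices, one too few to hold the
  whole cycle.\<close>

lemma red_candidates_card_B:
  assumes "x \<in> red_candidates"
  shows "card (fst x \<inter> B) \<in> {1..t}"
proof -
  have x: "x \<in> cycle_copies" using assms by (simp add: red_candidates_def)
  have W: "fst x \<subseteq> A \<union> B" "card (fst x) = 2 * t" using cycle_copiesE[OF x] by metis+
  have "fst x \<inter> B \<noteq> {}"
  proof
    assume "fst x \<inter> B = {}"
    then have "fst x \<subseteq> A" using W by blast
    then have "2 * t \<le> 2 * t - 1" using card_mono[OF finite_A] W card_A by metis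
    then show False using t_ge by simp
  qed
  then have "0 < card (fst x \<inter> B)" using finite_B by (simp add: card_gt_0_iff)
  moreover have "card (fst x \<inter> B) \<le> t" using card_mono[OF finite_B, of "fst x \<inter> B"] card_B by simp
  ultimately show ?thesis by simp
qed

text \<open>The vertex set consists of \<open>k\<close> vertices of \<open>B\<close> and
  \<open>2 * t - k\<close> of \<open>A\<close>; \<open>card_cycles_on_le\<close> bounds the cycles
  on it.\<close>

lemma card_red_candidates_le:
  "card {x \<in> red_candidates. card (fst x \<inter> B) = k} \<le> (t choose k) * ((2 * t - 1) choose (2 * t - k)) * fact (2 * t - 1)"
proof -
  define \<W> where "\<W> = {W. W \<subseteq> A \<union> B \<and> card W = 2 * t \<and> card (W \<inter> B) = k}"
  define cycles where "cycles W = {cycle_edges xs |xs. distinct xs \<and> set xs = W}" for W :: "nat set"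
  have fin\<W>: "finite \<W>"
    by (rule finite_subset[of _ "Pow (A \<union> B)"]) (use finite_A finite_B in \<open>auto simp: \<W>_def\<close>)
  have W: "finite W" "W \<noteq> {}" if "W \<in> \<W>" for W
    using that t_ge finite_A finite_B by (auto simp: \<W>_def intro: finite_subset)
  have "\<W> \<subseteq> (\<lambda>(X, Y). X \<union> Y) ` ({X. X \<subseteq> A \<and> card X = 2 * t - k} \<times> {Y. Y \<subseteq> B \<and> card Y = k})"
  proof
    fix W assume w: "W \<in> \<W>"
    have eq: "W = (W \<inter> A) \<union> (W \<inter> B)" using w by (auto simp: \<W>_def)
    have "card W = card (W \<inter> A) + card (W \<inter> B)"
      using disj finite_A finite_B by (subst eq, subst card_Un_disjoint) auto
    then have "(W \<inter> A, W \<inter> B) \<in> {X. X \<subseteq> A \<and> card X = 2 * t - k} \<times> {Y. Y \<subseteq> B \<and> card Y = k}"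
      using w by (auto simp: \<W>_def)
    then show "W \<in> (\<lambda>(X, Y). X \<union> Y) ` ({X. X \<subseteq> A \<and> card X = 2 * t - k} \<times> {Y. Y \<subseteq> B \<and> card Y = k})"
      using eq by (intro image_eqI[of _ _ "(W \<inter> A, W \<inter> B)"]) auto
  qed
  then have "card \<W> \<le> card ({X. X \<subseteq> A \<and> card X = 2 * t - k} \<times> {Y. Y \<subseteq> B \<and> card Y = k})"
    using finite_A finite_B by (intro surj_card_le) auto
  also have "\<dots> = ((2 * t - 1) choose (2 * t - k)) * (t choose k)"
    using finite_A finite_B card_A card_B by (simp add: card_cartesian_product n_subsets)
  finally have card\<W>: "card \<W> \<le> ((2 * t - 1) choose (2 * t - k)) * (t choose k)" .
  have "{x \<in> red_candidates. card (fst x \<inter> B) = k} \<subseteq> Sigma \<W> cycles"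
    by (auto simp: red_candidates_def \<W>_def cycles_def elim!: cycle_copiesE)
  then have "card {x \<in> red_candidates. card (fst x \<inter> B) = k} \<le> card (Sigma \<W> cycles)"
    using fin\<W> card_cycles_on_le(1)[OF W] by (intro card_mono finite_SigmaI) (auto simp: cycles_def)
  also have "\<dots> = (\<Sum>W\<in>\<W>. card (cycles W))"
    using fin\<W> card_cycles_on_le(1)[OF W] by (intro card_SigmaI) (auto simp: cycles_def)
  also have "\<dots> \<le> (\<Sum>W\<in>\<W>. fact (2 * t - 1))"
  proof (rule sum_mono)
    fix W assume w: "W \<in> \<W>"
    then have "card W = 2 * t" by (simp add: \<W>_def)
    then show "card (cycles W) \<le> fact (2 * t - 1)"
      using card_cycles_on_le(2)[OF W[OF w]] by (simp add: cycles_def)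
  qed
  also have "\<dots> = card \<W> * fact (2 * t - 1)" by simp
  also have "\<dots> \<le> (t choose k) * ((2 * t - 1) choose (2 * t - k)) * fact (2 * t - 1)"
    using card\<W> by (simp add: mult.commute)
  finally show ?thesis .
qed

text \<open>Each vertex in \<open>A\<close> uses up two of the at most \<open>2 * t\<close> edges,
  so at most \<open>t\<close> vertices lie in \<open>A\<close>. As \<open>B\<close> has only
  \<open>t\<close> vertices, equality holds throughout and the cycle has \<open>2 * t\<close> edges
  between the parts.\<close>

lemma blue_candidates_structure:
  assumes "x \<in> blue_candidates"
  shows "B \<subseteq> fst x" "card (fst x \<inter> A) = t" "2 * t \<le> card (snd x \<inter> cross_edges)"
proof -
  have x: "x \<in> cycle_copies" "\<forall>e\<in>snd x. \<not> e \<subseteq> A" using assms by (auto simp: blue_candidates_def)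
  have c: "2 * card (fst x \<inter> A) \<le> card (snd x \<inter> cross_edges)" "card (snd x) \<le> 2 * t"
    using card_crossing_edges[of x A] x by auto
  have "card (snd x \<inter> cross_edges) \<le> card (snd x)"
    using finite_snd[OF x(1)] by (intro card_mono) auto
  then have le: "card (fst x \<inter> A) \<le> t" using c by simp
  have W: "fst x \<subseteq> A \<union> B" "card (fst x) = 2 * t" using cycle_copiesE[OF x(1)] by metis+
  have "card (fst x) = card (fst x \<inter> A) + card (fst x \<inter> B)"
  proof -
    have eq: "fst x = (fst x \<inter> A) \<union> (fst x \<inter> B)" using W by auto
    show ?thesis using disj finite_A finite_B by (subst eq, subst card_Un_disjoint) auto
  qed
  moreover have leB: "card (fst x \<inter> B) \<le> t" using card_mono[OF finite_B, of "fst x \<inter> B"] card_B by simp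
  ultimately have "card (fst x \<inter> B) = card B" "card (fst x \<inter> A) = t" using le W card_B by auto
  then show "B \<subseteq> fst x" "card (fst x \<inter> A) = t"
    using card_subset_eq[OF finite_B, of "fst x \<inter> B"] by auto
  then show "2 * t \<le> card (snd x \<inter> cross_edges)" using c by simp
qed

definition alternating :: "nat list \<times> nat list \<Rightarrow> nat list" where
  "alternating = (\<lambda>(bs, as). map (\<lambda>i. if even i then bs ! (i div 2) else as ! (i div 2)) [0..<2 * t])"

text \<open>List the cycle from \<open>b\<close>. The \<open>t\<close> positions in \<open>A\<close>
  and their \<open>t\<close> predecessors are disjoint, hence exhaust all positions; so membership
  in \<open>A\<close> alternates, starting outside \<open>A\<close>.\<close>

lemma blue_candidates_alternating:
  assumes x: "x \<in> blue_candidates" and b: "b \<in> B"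
  shows "\<exists>bs as. distinct (b # bs) \<and> set (b # bs) = B \<and> distinct as \<and> length as = t \<and> set as \<subseteq> A \<and>
    fst x = set (alternating (b # bs, as)) \<and> snd x = cycle_edges (alternating (b # bs, as))"
proof -
  have xK: "x \<in> cycle_copies" "\<forall>e\<in>snd x. \<not> e \<subseteq> A" using x by (auto simp: blue_candidates_def)
  obtain ys where ys: "distinct ys" "length ys = 2 * t" "set ys = fst x" "snd x = cycle_edges ys"
    "fst x \<subseteq> A \<union> B" using cycle_copiesE[OF xK(1)] by metis
  have "b \<in> set ys" using blue_candidates_structure(1)[OF x] b ys by auto
  then obtain zs where zs: "distinct (b # zs)" "length (b # zs) = length ys"
    "set (b # zs) = set ys" "cycle_edges (b # zs) = cycle_edges ys"
    using obtain_rotation[OF ys(1)] by metis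
  define xs where "xs = b # zs"
  have xs: "distinct xs" "length xs = 2 * t" "set xs = fst x" "snd x = cycle_edges xs" "xs ! 0 = b"
    using zs ys by (auto simp: xs_def)
  define J J' where "J = {i. i < 2 * t \<and> xs ! i \<in> A}" and "J' = {i. Suc i < 2 * t \<and> xs ! Suc i \<in> A}"
  have noAA: False if "Suc i < 2 * t" "xs ! i \<in> A" "xs ! Suc i \<in> A" for i
  proof -
    have "{xs ! i, xs ! (Suc i mod length xs)} \<in> snd x"
      unfolding xs(4) cycle_edges_def using that(1) xs(2) by auto
    then show False using xK(2) that xs(2) by auto
  qed
  have cJ: "card J = t"
  proof -
    have "fst x \<inter> A = (!) xs ` J" using xs by (auto simp: J_def in_set_conv_nth simp flip: xs(3))
    moreover have "inj_on ((!) xs) J" using xs by (auto simp: J_def inj_on_def nth_eq_iff_index_eq)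
    ultimately show ?thesis using blue_candidates_structure(2)[OF x] by (simp add: card_image)
  qed
  have "xs ! 0 \<notin> A" using xs(5) b disj by auto
  have "card J' = card J"
  proof -
    have "J = Suc ` J'"
    proof
      show "J \<subseteq> Suc ` J'"
      proof
        fix j assume "j \<in> J"
        then show "j \<in> Suc ` J'" using \<open>xs ! 0 \<notin> A\<close> by (cases j) (auto simp: J_def J'_def)
      qed
    qed (auto simp: J_def J'_def)
    then show ?thesis by (simp add: card_image)
  qed
  moreover have "J \<inter> J' = {}" using noAA by (auto simp: J_def J'_def)
  ultimately have "card (J \<union> J') = 2 * t"
    using cJ by (subst card_Un_disjoint) (auto simp: J_def J'_def)
  moreover have "J \<union> J' \<subseteq> {..<2 * t}" by (auto simp: J_def J'_def)
  ultimately have JJ: "J \<union> J' = {..<2 * t}" by (intro card_subset_eq) auto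
  have step: "xs ! Suc i \<in> A \<longleftrightarrow> xs ! i \<notin> A" if "Suc i < 2 * t" for i
  proof -
    have "i \<in> J \<union> J'" using JJ that by auto
    then show ?thesis using noAA[OF that] by (auto simp: J_def J'_def)
  qed
  have parity: "xs ! i \<in> A \<longleftrightarrow> odd i" if "i < 2 * t" for i
    using that
  proof (induction i)
    case 0
    then show ?case using \<open>xs ! 0 \<notin> A\<close> by simp
  next
    case (Suc i)
    then show ?case using step[of i] by simp
  qed
  define bs as where "bs = map (\<lambda>j. xs ! (2 * j)) [1..<t]" and "as = map (\<lambda>j. xs ! (2 * j + 1)) [0..<t]"
  have bbs: "b # bs = map (\<lambda>j. xs ! (2 * j)) [0..<t]"
    using t_ge xs(5) by (simp add: bs_def upt_rec[of 0])
  have alt: "alternating (b # bs, as) = xs"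
  proof (rule nth_equalityI)
    fix i assume "i < length (alternating (b # bs, as))"
    then have i: "i < 2 * t" by (simp add: alternating_def)
    then have "i div 2 < t" by simp
    then show "alternating (b # bs, as) ! i = xs ! i"
      using i unfolding alternating_def bbs as_def by (auto elim!: evenE oddE)
  qed (use xs in \<open>simp add: alternating_def\<close>)
  have "distinct (b # bs)" "distinct as"
    unfolding bbs as_def distinct_map using xs
    by (auto simp: inj_on_def nth_eq_iff_index_eq)
  moreover have "set as \<subseteq> A" unfolding as_def using parity by auto
  moreover have "set (b # bs) = B"
  proof (rule card_subset_eq)
    show "set (b # bs) \<subseteq> B"
    proof
      fix v assume "v \<in> set (b # bs)"
      then obtain j where j: "j < t" "v = xs ! (2 * j)" unfolding bbs by auto
      then have "v \<in> set xs" "v \<notin> A" using parity[of "2 * j"] xs(2) by auto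
      then show "v \<in> B" using xs(3) ys(5) by auto
    qed
    show "card (set (b # bs)) = card B"
      using \<open>distinct (b # bs)\<close> distinct_card[of "b # bs"] bbs card_B by (metis diff_zero length_map length_upt)
  qed (rule finite_B)
  ultimately show ?thesis using alt xs by (intro exI[of _ bs] exI[of _ as]) (auto simp: as_def)
qed

text \<open>There are \<open>(t - 1)!\<close> orders of the rest of \<open>B\<close> and
  \<open>t * (t + 1) * ... * (2 * t - 1)\<close> ordered choices from \<open>A\<close>; the product
  is exactly \<open>(2 * t - 1)!\<close>.\<close>

lemma card_blue_candidates_le: "card blue_candidates \<le> fact (2 * t - 1)"
proof -
  have "B \<noteq> {}" using card_B t_ge by auto
  then obtain b where b: "b \<in> B" by blast
  define P where "P = permutations_of_set (B - {b})"
  define Q where "Q = {as. length as = t \<and> distinct as \<and> set as \<subseteq> A}"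
  have finQ: "finite Q"
    by (rule finite_subset[OF _ finite_lists_length_eq[OF finite_A, of t]]) (auto simp: Q_def)
  have "blue_candidates \<subseteq> (\<lambda>(bs, as). (set (alternating (b # bs, as)), cycle_edges (alternating (b # bs, as)))) ` (P \<times> Q)"
  proof
    fix x assume "x \<in> blue_candidates"
    then obtain bs as where l: "distinct (b # bs)" "set (b # bs) = B" "distinct as" "length as = t" "set as \<subseteq> A"
      "fst x = set (alternating (b # bs, as))" "snd x = cycle_edges (alternating (b # bs, as))"
      using blue_candidates_alternating[OF _ b] by blast
    then have "(bs, as) \<in> P \<times> Q" by (auto simp: P_def Q_def permutations_of_set_def)
    then show "x \<in> (\<lambda>(bs, as). (set (alternating (b # bs, as)), cycle_edges (alternating (b # bs, as)))) ` (P \<times> Q)"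
      using l by (intro image_eqI[of _ _ "(bs, as)"]) (auto simp: prod_eq_iff)
  qed
  then have "card blue_candidates \<le> card (P \<times> Q)"
    using finQ finite_B by (intro surj_card_le) (auto simp: P_def)
  also have "\<dots> = fact (t - 1) * \<Prod>{t..2 * t - 1}"
  proof -
    have "card Q = \<Prod>{card A - t + 1..card A}"
      unfolding Q_def using finite_A card_A t_ge by (intro card_lists_distinct_length_eq) auto
    also have "card A - t + 1 = t" using card_A t_ge by simp
    finally show ?thesis using finite_B b card_A card_B by (simp add: card_cartesian_product P_def)
  qed
  also have "\<dots> = fact (2 * t - 1)"
  proof -
    have "{1..2 * t - 1} = {1..t - 1} \<union> {t..2 * t - 1}" using t_ge by auto
    then have "\<Prod>{1..2 * t - 1} = \<Prod>{1..t - 1} * \<Prod>{t..2 * t - 1}"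
      using t_ge by (simp add: prod.union_disjoint del: One_nat_def)
    then show ?thesis by (simp add: fact_prod)
  qed
  finally show ?thesis .
qed

text \<open>A red candidate with \<open>k\<close> vertices in \<open>B\<close> has at least
  \<open>2 * k\<close> random edges, a blue candidate at least \<open>2 * t\<close>. Since
  \<open>0 \<le> p \<le> 1\<close>, further edges only lower the probability.\<close>

theorem exists_colouring:
  fixes p :: real
  assumes p: "0 \<le> p" "p \<le> 1"
  shows "\<exists>c. real (mono_count (cycle_graph (2 * t)) (3 * t - 1) c) \<le>
    fact (2 * t - 1) * ((\<Sum>k=1..t. real (t choose k) * real ((2 * t - 1) choose (2 * t - k)) * p ^ (2 * k))
      + (1 - p) ^ (2 * t))"
proof -
  obtain S where S: "real (card {x \<in> red_candidates. snd x \<inter> cross_edges \<subseteq> S} + card {x \<in> blue_candidates. snd x \<inter> cross_edges \<inter> S = {}})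
    \<le> (\<Sum>x\<in>red_candidates. p ^ card (snd x \<inter> cross_edges)) + (\<Sum>x\<in>blue_candidates. (1 - p) ^ card (snd x \<inter> cross_edges))"
    using exists_subset_le_expectation[OF p finite_cross_edges finite_red_candidates finite_blue_candidates, of "\<lambda>x. snd x \<inter> cross_edges"] by auto
  have "(\<Sum>x\<in>red_candidates. p ^ card (snd x \<inter> cross_edges)) \<le> (\<Sum>x\<in>red_candidates. p ^ (2 * card (fst x \<inter> B)))"
    using card_crossing_edges(1)[of _ B] p
    by (intro sum_mono power_decreasing) (auto simp: red_candidates_def)
  also have "\<dots> = (\<Sum>k\<in>{1..t}. \<Sum>x\<in>{x \<in> red_candidates. card (fst x \<inter> B) = k}. p ^ (2 * card (fst x \<inter> B)))"
    using finite_red_candidates red_candidates_card_B by (intro sum.group[symmetric]) auto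
  also have "\<dots> = (\<Sum>k\<in>{1..t}. real (card {x \<in> red_candidates. card (fst x \<inter> B) = k}) * p ^ (2 * k))"
    by (intro sum.cong refl) simp
  also have "\<dots> \<le> (\<Sum>k\<in>{1..t}. real ((t choose k) * ((2 * t - 1) choose (2 * t - k)) * fact (2 * t - 1)) * p ^ (2 * k))"
    using p by (intro sum_mono mult_right_mono of_nat_mono card_red_candidates_le) auto
  also have "\<dots> = fact (2 * t - 1) * (\<Sum>k=1..t. real (t choose k) * real ((2 * t - 1) choose (2 * t - k)) * p ^ (2 * k))"
    by (simp add: sum_distrib_left mult_ac)
  finally have 1: "(\<Sum>x\<in>red_candidates. p ^ card (snd x \<inter> cross_edges)) \<le>
    fact (2 * t - 1) * (\<Sum>k=1..t. real (t choose k) * real ((2 * t - 1) choose (2 * t - k)) * p ^ (2 * k))" .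
  have "(\<Sum>x\<in>blue_candidates. (1 - p) ^ card (snd x \<inter> cross_edges)) \<le> (\<Sum>x\<in>blue_candidates. (1 - p) ^ (2 * t))"
    using blue_candidates_structure(3) p by (intro sum_mono power_decreasing) auto
  also have "\<dots> = real (card blue_candidates) * (1 - p) ^ (2 * t)" by simp
  also have "\<dots> \<le> real (fact (2 * t - 1)) * (1 - p) ^ (2 * t)"
    using p by (intro mult_right_mono of_nat_mono card_blue_candidates_le) auto
  finally have 2: "(\<Sum>x\<in>blue_candidates. (1 - p) ^ card (snd x \<inter> cross_edges)) \<le> fact (2 * t - 1) * (1 - p) ^ (2 * t)" by simp
  show ?thesis
    by (rule exI[of _ "colouring S"])
      (use S 1 2 mono_count_le[of S] in \<open>simp add: ring_distribs\<close>)
qed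

end

section \<open>Optimising the probability\<close>

text \<open>The target is an odd term of the exponential series at \<open>sqrt 2 * d\<close>, so
  that summing over \<open>k\<close> gives an exponential. The binomials are replaced by powers over
  factorials.\<close>

lemma red_term_le:
  fixes d :: real
  assumes k: "1 \<le> k" "k \<le> t" and d: "0 \<le> d" and t: "1 \<le> t"
  shows "real (t choose k) * real ((2 * t - 1) choose (2 * t - k)) * (d / (2 * t)) ^ (2 * k)
    \<le> sqrt 2 * d / (4 * t) * ((sqrt 2 * d) ^ (2 * k - 1) / fact (2 * k - 1))"
proof -
  obtain j where j: "k = Suc j" using k by (cases k) auto
  have "(2 * t - 1) choose (2 * t - k) = (2 * t - 1) choose j"
    using k j binomial_symmetric[of j "2 * t - 1"] by simp
  moreover have "real ((2 * t - 1) choose j) \<le> (2 * t) ^ j / fact j"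
  proof -
    have "((2 * t - 1) choose j) * fact j \<le> (2 * t - 1) ^ j" by (rule binomial_fact_pow)
    also have "\<dots> \<le> (2 * t) ^ j" by (intro power_mono) auto
    finally have "real (((2 * t - 1) choose j) * fact j) \<le> real ((2 * t) ^ j)" by (rule of_nat_mono)
    then show ?thesis by (simp add: field_simps)
  qed
  moreover have "real (t choose k) \<le> t ^ k / fact k"
  proof -
    have "real ((t choose k) * fact k) \<le> real (t ^ k)" by (intro of_nat_mono binomial_fact_pow)
    then show ?thesis by (simp add: field_simps)
  qed
  ultimately have "real (t choose k) * real ((2 * t - 1) choose (2 * t - k)) * (d / (2 * t)) ^ (2 * k)
    \<le> (t ^ k / fact k) * ((2 * t) ^ j / fact j) * (d / (2 * t)) ^ (2 * k)"
    using d by (intro mult_right_mono mult_mono) auto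
  also have "\<dots> = d ^ (2 * k) / (2 ^ k * (2 * t)) * (k / (fact k * fact k))"
  proof -
    have 1: "real t ^ k * (2 * real t) ^ j * (d / (2 * t)) ^ (2 * k) = d ^ (2 * k) / (2 ^ k * (2 * t))"
      using t unfolding j by (simp add: field_simps power_mult_distrib power_mult power2_eq_square)
    have f: "(fact k :: real) = real k * fact j" unfolding j by simp
    have "real k / (fact k * (real k * fact j)) = 1 / (fact k * fact j)" using k by simp
    then have 2: "1 / (fact k * fact j) = real k / (fact k * fact k)" unfolding f[symmetric] by simp
    have "(t ^ k / fact k) * ((2 * t) ^ j / fact j) * (d / (2 * t)) ^ (2 * k) =
      (real t ^ k * (2 * real t) ^ j * (d / (2 * t)) ^ (2 * k)) * (1 / (fact k * fact j))" by simp
    then show ?thesis unfolding 1 2 .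
  qed
  \<comment> \<open>The central binomial coefficient is at most \<open>4 ^ k\<close>. With the
    \<open>2 ^ k\<close> in the denominator this leaves \<open>2 ^ k = sqrt 2 ^ (2 * k)\<close>, the
    source of \<open>sqrt 2\<close> in the exponent.\<close>
  also have "\<dots> \<le> d ^ (2 * k) / (2 ^ k * (2 * t)) * (k * 4 ^ k / fact (2 * k))"
  proof -
    have "fact k * fact k * ((2 * k) choose k) = (fact (2 * k) :: nat)"
      using binomial_fact_lemma[of k "2 * k"] by simp
    moreover have "(2 * k) choose k \<le> 2 ^ (2 * k)" by (rule binomial_le_pow2)
    moreover have "(2 :: nat) ^ (2 * k) = 4 ^ k" by (simp add: power_mult)
    ultimately have "(fact (2 * k) :: nat) \<le> fact k * fact k * 4 ^ k"
      by (metis mult_le_mono2)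
    then have "real (fact (2 * k)) \<le> real (fact k * fact k * 4 ^ k)" by (rule of_nat_mono)
    then have "1 / (fact k * fact k :: real) \<le> 4 ^ k / fact (2 * k)" by (simp add: field_simps)
    then have "real k * (1 / (fact k * fact k)) \<le> k * (4 ^ k / fact (2 * k))" by (intro mult_left_mono) auto
    then show ?thesis using d by (intro mult_left_mono) auto
  qed
  also have "\<dots> = sqrt 2 * d / (4 * t) * ((sqrt 2 * d) ^ (2 * k - 1) / fact (2 * k - 1))"
  proof -
    have f: "(fact (2 * k) :: real) = 2 * k * fact (2 * k - 1)"
      using k by (simp add: fact_reduce)
    have "(4 :: real) ^ k = 2 ^ k * 2 ^ k" by (simp flip: power_mult_distrib)
    then have "d ^ (2 * k) / (2 ^ k * (2 * t)) * (k * 4 ^ k / fact (2 * k))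
      = d ^ (2 * k) * 2 ^ k / (4 * t * fact (2 * k - 1))"
      unfolding f using k t by (simp add: field_simps)
    also have "d ^ (2 * k) * 2 ^ k = (sqrt 2 * d) ^ (2 * k)"
      by (simp add: power_mult_distrib power_mult)
    also have "(sqrt 2 * d) ^ (2 * k) = sqrt 2 * d * (sqrt 2 * d) ^ (2 * k - 1)"
      using k by (simp flip: power_Suc)
    finally show ?thesis by simp
  qed
  finally show ?thesis .
qed

text \<open>The bounds of \<open>red_term_le\<close> are finitely many odd terms of the exponential
  series, all of whose terms are nonnegative.\<close>

lemma red_sum_le:
  fixes d :: real
  assumes d: "0 \<le> d" and t: "1 \<le> t"
  shows "(\<Sum>k=1..t. real (t choose k) * real ((2 * t - 1) choose (2 * t - k)) * (d / (2 * t)) ^ (2 * k))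
    \<le> sqrt 2 * d / (4 * t) * exp (sqrt 2 * d)"
proof -
  define y where "y = sqrt 2 * d"
  have y: "0 \<le> y" using d by (simp add: y_def)
  have "(\<Sum>k=1..t. y ^ (2 * k - 1) / fact (2 * k - 1)) = (\<Sum>m\<in>(\<lambda>k. 2 * k - 1) ` {1..t}. y ^ m / fact m)"
    by (subst sum.reindex) (auto simp: inj_on_def)
  also have "\<dots> \<le> (\<Sum>m. y ^ m / fact m)"
    using summable_exp[of y] y by (intro sum_le_suminf) (auto simp: field_simps)
  also have "\<dots> = exp y" by (simp add: exp_def field_simps)
  finally have s: "(\<Sum>k=1..t. y ^ (2 * k - 1) / fact (2 * k - 1)) \<le> exp y" .
  have "(\<Sum>k=1..t. real (t choose k) * real ((2 * t - 1) choose (2 * t - k)) * (d / (2 * t)) ^ (2 * k))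
    \<le> (\<Sum>k=1..t. y / (4 * t) * (y ^ (2 * k - 1) / fact (2 * k - 1)))"
    unfolding y_def using d t by (intro sum_mono red_term_le) auto
  also have "\<dots> = y / (4 * t) * (\<Sum>k=1..t. y ^ (2 * k - 1) / fact (2 * k - 1))"
    by (rule sum_distrib_left[symmetric])
  also have "\<dots> \<le> y / (4 * t) * exp y" using s y by (intro mult_left_mono) auto
  finally show ?thesis by (simp add: y_def)
qed

lemma exists_colouring_powr:
  assumes t: "2 \<le> t"
  shows "\<exists>c. real (mono_count (cycle_graph (2 * t)) (3 * t - 1) c) \<le>
    (2 + ln t) * real t powr (- 1 / (1 + sqrt 2)) * (fact (2 * t - 1) / 2)"
proof -
  interpret two_parts t "{..<2 * t - 1}" "{2 * t - 1..<3 * t - 1}"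
    by unfold_locales (use t in auto)
  txt \<open>The choice \<open>p = d / (2 * t)\<close> balances the blue bound \<open>exp (- d)\<close> against the red bound
    \<open>exp (sqrt 2 * d) / t\<close>.\<close>
  define \<alpha> where "\<alpha> = 1 / (1 + sqrt 2)"
  have "0 < 1 + sqrt (2 :: real)" by (simp add: add_pos_pos)
  then have "\<alpha> * (1 + sqrt 2) = 1" and \<alpha>_pos: "0 < \<alpha>" by (simp_all add: \<alpha>_def)
  \<comment> \<open>This identity makes the red and blue bounds agree up to a logarithm:
    \<open>t powr (sqrt 2 * \<alpha> - 1) = t powr (- \<alpha>)\<close>.\<close>
  then have \<alpha>: "sqrt 2 * \<alpha> = 1 - \<alpha>" by (simp add: algebra_simps)
  moreover have "0 \<le> sqrt 2 * \<alpha>" using \<alpha>_pos by simp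
  ultimately have \<alpha>_le: "\<alpha> \<le> 1" "sqrt 2 * \<alpha> \<le> 1" using \<alpha>_pos by linarith+
  define d where "d = \<alpha> * ln t"
  have ln: "0 \<le> ln (real t)" "ln (real t) \<le> t" using t ln_le_minus_one[of "real t"] by auto
  have d: "0 \<le> d" "d \<le> t" using \<alpha>_pos \<alpha>_le ln mult_mono[of \<alpha> 1 "ln t" t] by (auto simp: d_def)
  have p: "0 \<le> d / (2 * t)" "d / (2 * t) \<le> 1" using d t by (auto simp: field_simps)
  have e1: "exp (- d) = real t powr (- \<alpha>)" using t by (simp add: powr_def d_def)
  have e2: "exp (sqrt 2 * d) = real t * real t powr (- \<alpha>)"
  proof -
    have "exp (sqrt 2 * d) = real t powr (1 - \<alpha>)"
      using t \<alpha> by (simp add: powr_def d_def mult.assoc[symmetric])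
    then show ?thesis using t by (simp add: powr_diff powr_minus field_simps)
  qed
  have "(1 - d / (2 * t)) ^ (2 * t) \<le> exp (- (d / (2 * t))) ^ (2 * t)"
    using p exp_ge_add_one_self[of "- (d / (2 * t))"] by (intro power_mono) auto
  also have "\<dots> = exp (- d)" using t by (simp flip: exp_of_nat_mult)
  finally have blue: "(1 - d / (2 * t)) ^ (2 * t) \<le> real t powr (- \<alpha>)" unfolding e1 .
  have "sqrt 2 * d \<le> 1 * ln t" unfolding d_def mult.assoc[symmetric] using \<alpha>_le ln by (intro mult_right_mono) auto
  then have "sqrt 2 * d / (4 * t) * exp (sqrt 2 * d) \<le> ln t / (4 * t) * (real t * real t powr (- \<alpha>))"
    unfolding e2 using t by (intro mult_right_mono divide_right_mono) auto
  also have "\<dots> = ln t / 4 * real t powr (- \<alpha>)" using t by simp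
  finally have r: "sqrt 2 * d / (4 * t) * exp (sqrt 2 * d) \<le> ln t / 4 * real t powr (- \<alpha>)" .
  have "1 \<le> t" using t by simp
  from order_trans[OF red_sum_le[OF d(1) this] r]
  have red: "(\<Sum>k=1..t. real (t choose k) * real ((2 * t - 1) choose (2 * t - k)) * (d / (2 * t)) ^ (2 * k))
    \<le> ln t / 4 * real t powr (- \<alpha>)" .
  obtain c where "real (mono_count (cycle_graph (2 * t)) (3 * t - 1) c) \<le> fact (2 * t - 1) *
      ((\<Sum>k=1..t. real (t choose k) * real ((2 * t - 1) choose (2 * t - k)) * (d / (2 * t)) ^ (2 * k))
        + (1 - d / (2 * t)) ^ (2 * t))"
    using exists_colouring[OF p] by auto
  also have "\<dots> \<le> fact (2 * t - 1) * (ln t / 4 * real t powr (- \<alpha>) + real t powr (- \<alpha>))"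
    using red blue by (intro mult_left_mono add_mono) auto
  \<comment> \<open>The bracket doubles because the bound is now measured against
    \<open>(2 * t - 1)! / 2\<close>.\<close>
  also have "\<dots> = (2 + ln t / 2) * real t powr (- \<alpha>) * (fact (2 * t - 1) / 2)" by (simp add: field_simps)
  also have "\<dots> \<le> (2 + ln t) * real t powr (- \<alpha>) * (fact (2 * t - 1) / 2)"
    using ln by (intro mult_right_mono) auto
  finally show ?thesis unfolding \<alpha>_def by auto
qed

theorem theorem3:
  shows "\<exists>\<epsilon> :: nat \<Rightarrow> real. \<epsilon> \<longlonglongrightarrow> 0 \<and>
    (\<forall>\<^sub>F t in sequentially.
       real (threshold_ramsey_multiplicity (cycle_graph (2 * t)))
         \<le> real t powr (- 1 / (1 + sqrt 2) + \<epsilon> t) * (fact (2 * t - 1) / 2))"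
proof (intro exI conjI)
  \<comment> \<open>Chosen so that \<open>t powr \<epsilon> t\<close> is exactly the logarithmic
    factor \<open>2 + ln t\<close>.\<close>
  define \<epsilon> where "\<epsilon> t = ln (2 + ln (real t)) / ln (real t)" for t :: nat
  show "\<epsilon> \<longlonglongrightarrow> 0" unfolding \<epsilon>_def by real_asymp
  obtain t0 where t0: "\<And>t. t0 \<le> t \<Longrightarrow> ramsey_number (cycle_graph (2 * t)) \<le> 3 * t - 1"
    using ramsey_number_even_cycle_le by blast
  show "\<forall>\<^sub>F t in sequentially. real (threshold_ramsey_multiplicity (cycle_graph (2 * t)))
      \<le> real t powr (- 1 / (1 + sqrt 2) + \<epsilon> t) * (fact (2 * t - 1) / 2)"
    using eventually_ge_at_top[of "max 2 t0"]
  proof eventually_elim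
    case (elim t)
    then have t: "2 \<le> t" "t0 \<le> t" by auto
    obtain c where c: "real (mono_count (cycle_graph (2 * t)) (3 * t - 1) c) \<le>
        (2 + ln t) * real t powr (- 1 / (1 + sqrt 2)) * (fact (2 * t - 1) / 2)"
      using exists_colouring_powr[OF t(1)] by blast
    have "real (threshold_ramsey_multiplicity (cycle_graph (2 * t)))
        \<le> real (mono_count (cycle_graph (2 * t)) (3 * t - 1) c)"
      using threshold_ramsey_multiplicity_le[OF t0[OF t(2)]] by (rule of_nat_mono)
    also note c
    also have "2 + ln (real t) = real t powr \<epsilon> t"
    proof -
      have "0 < ln (real t)" using t by simp
      moreover from this have "exp (ln (2 + ln (real t))) = 2 + ln (real t)" by (subst exp_ln) auto
      ultimately show ?thesis using t by (simp add: powr_def \<epsilon>_def)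
    qed
    also have "real t powr \<epsilon> t * real t powr (- 1 / (1 + sqrt 2)) = real t powr (- 1 / (1 + sqrt 2) + \<epsilon> t)"
      unfolding powr_add by (rule mult.commute)
    finally show ?case .
  qed
qed

end
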